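(* Let $\Omega\subset\mathbb{R}^d$ be a bounded star-shaped Lipschitz domain such that its complement $\complement\Omega=\mathbb{R}^d\setminus\Omega$ has positive reach. Then $K:=\overline{\Omega}$ has an optimal polynomial admissible mesh.
   Context: Notation: $\mathscr{P}^n(\mathbb{R}^d)$ is the space of real polynomials in $d$ real variables of total degree at most $n$; $\|f\|_X:=\sup_{x\in X}|f(x)|$; $|\cdot|$ is the Euclidean norm; $B(a,r)$ is the Euclidean ball with center $a$ and radius $r$. Admissible meshes: let $K\subset\mathbb{R}^d$ be compact and polynomial determining (any polynomial vanishing on $K$ is the null polynomial). An admissible mesh for $K$ is a sequence $\{A_n\}_{n}$ of finite subsets of $K$ such that $\operatorname{Card}(A_n)$ grows at most polynomially in $n$ and there is a constant $C>0$, independent of $n$, with $\|p\|_K\le C\|p\|_{A_n}$ for all $p\in\mathscr{P}^n(\mathbb{R}^d)$ and all $n$. It is called optimal if $\operatorname{Card}(A_n)=O(n^d)$. Star-shaped: there is a point $x_0\in\Omega$ (the center of the star) such that the segment $[x_0,x]$ is contained in $\Omega$ for every $x\in\Omega$. Lipschitz domain: a domain $\Omega\subset\mathbb{R}^d$ is a (uniformly) Lipschitz domain if there exist $0<L<\infty$, $r>0$ and an open neighbourhood $B$ of $0$ in $\mathbb{R}^{d-1}$ such that for every $x\in\partial\Omega$ there exist $\varphi_x:B\to\,]-r,r[$ and a rotation $R_x\in SO_d$ with $\varphi_x(0)=0$, Lipschitz constant $\operatorname{Lip}(\varphi_x)\le L$, and $$R_x^{-1}\left(\Omega\cap\left(x+R_x(B\times]-r,r[)\right)-x\right)=\{(\xi,t):\xi\in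 B,\ t\in\,]-r,\varphi_x(\xi)[\}.$$ Reach: for $A\subset\mathbb{R}^d$ let $d_A(x):=\inf_{y\in A}|x-y|$, $\operatorname{proj}_A(x):=\{y\in A:|y-x|=d_A(x)\}$, and let $Unp(A)$ be the set of $x\in\mathbb{R}^d$ for which $\operatorname{proj}_A(x)$ consists of exactly one point. For $a\in A$ set $\operatorname{Reach}(A,a):=\sup\{r>0:B(a,r)\subseteq Unp(A)\}$, and $\operatorname{Reach}(A):=\inf_{a\in A}\operatorname{Reach}(A,a)$. The set $A$ has positive reach if $\operatorname{Reach}(A)>0$. *)

theory Defs
  imports "HOL-Analysis.Analysis" "HOL-Library.Landau_Symbols"
begin

definition polys :: "nat \<Rightarrow> (real ^ 'n \<Rightarrow> real) set" where
  "polys n = {p. \<exists>c :: ('n \<Rightarrow> nat) \<Rightarrow> real.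
     p = (\<lambda>x. \<Sum>\<alpha> | sum \<alpha> UNIV \<le> n. c \<alpha> * (\<Prod>i\<in>UNIV. (x $ i) ^ \<alpha> i))}"

text \<open>The index set of the sum above is finite, so the sum does not degenerate to \<open>0\<close>.\<close>

lemma finite_exponents: "finite {\<alpha> :: 'n::finite \<Rightarrow> nat. sum \<alpha> UNIV \<le> n}"
proof (rule finite_subset)
  show "{\<alpha> :: 'n \<Rightarrow> nat. sum \<alpha> UNIV \<le> n} \<subseteq> (UNIV :: 'n set) \<rightarrow>\<^sub>E {..n}"
    by (auto simp: PiE_UNIV_domain intro: order_trans[OF member_le_sum[of _ UNIV]])
  show "finite ((UNIV :: 'n set) \<rightarrow>\<^sub>E {..n})"
    by (intro finite_PiE) auto
qed

text \<open>Taken in \<^typ>\<open>ennreal\<close>, so that the supremum over the empty set is \<open>0\<close> and unbounded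
  functions have norm \<open>\<infinity>\<close>.\<close>

definition sup_norm :: "'a set \<Rightarrow> ('a \<Rightarrow> real) \<Rightarrow> ennreal" where
  "sup_norm X f = (SUP x\<in>X. ennreal \<bar>f x\<bar>)"

definition polynomial_determining :: "(real ^ 'n) set \<Rightarrow> bool" where
  "polynomial_determining K \<longleftrightarrow>
     (\<forall>n. \<forall>p\<in>polys n. (\<forall>x\<in>K. p x = 0) \<longrightarrow> p = (\<lambda>x. 0))"

definition admissible_mesh :: "(real ^ 'n) set \<Rightarrow> (nat \<Rightarrow> (real ^ 'n) set) \<Rightarrow> bool" where
  "admissible_mesh K A \<longleftrightarrow>
     compact K \<and> polynomial_determining K \<and>
     (\<forall>n. finite (A n) \<and> A n \<subseteq> K) \<and>
     (\<exists>k::nat. (\<lambda>n. real (card (A n))) \<in> O(\<lambda>n. real n ^ k)) \<and>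
     (\<exists>C::real. C > 0 \<and> (\<forall>n. \<forall>p\<in>polys n. sup_norm K p \<le> ennreal C * sup_norm (A n) p))"

definition optimal_admissible_mesh :: "(real ^ 'n) set \<Rightarrow> (nat \<Rightarrow> (real ^ 'n) set) \<Rightarrow> bool" where
  "optimal_admissible_mesh K A \<longleftrightarrow>
     admissible_mesh K A \<and> (\<lambda>n. real (card (A n))) \<in> O(\<lambda>n. real n ^ CARD('n))"

text \<open>\<open>\<real>\<^sup>d\<close> is split as \<open>\<real>\<^sup>d\<^sup>-\<^sup>1 \<times> \<real>\<close> by singling out one coordinate \<open>k\<close>: \<open>\<real>\<^sup>d\<^sup>-\<^sup>1\<close> is the
  coordinate hyperplane \<open>base_hyperplane k\<close>, and the pair \<open>(\<xi>, t)\<close> is the vector \<open>cyl_point k \<xi> t\<close>.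
  The choice of \<open>k\<close> is immaterial, since two such splittings differ by a coordinate permutation,
  which is a rotation up to a reflection of the hyperplane.\<close>

definition base_hyperplane :: "'n \<Rightarrow> (real ^ 'n) set" where
  "base_hyperplane k = {\<xi>. \<xi> $ k = 0}"

definition cyl_point :: "'n \<Rightarrow> real ^ 'n \<Rightarrow> real \<Rightarrow> real ^ 'n" where
  "cyl_point k \<xi> t = \<xi> + t *\<^sub>R axis k 1"

definition lipschitz_domain :: "(real ^ 'n) set \<Rightarrow> bool" where
  "lipschitz_domain \<Omega> \<longleftrightarrow>
     open \<Omega> \<and> connected \<Omega> \<and> \<Omega> \<noteq> {} \<and>
     (\<exists>k (L::real) (r::real) B.
        0 < L \<and> 0 < r \<and> openin (top_of_set (base_hyperplane k)) B \<and> 0 \<in> B \<and>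
        (\<forall>x\<in>frontier \<Omega>. \<exists>(\<phi> :: real ^ 'n \<Rightarrow> real) (R :: real ^ 'n ^ 'n).
           \<phi> ` B \<subseteq> {-r<..<r} \<and> rotation_matrix R \<and> \<phi> 0 = 0 \<and> L-lipschitz_on B \<phi> \<and>
           (\<lambda>y. matrix_inv R *v (y - x)) `
              (\<Omega> \<inter> {x + R *v cyl_point k \<xi> t | \<xi> t. \<xi> \<in> B \<and> t \<in> {-r<..<r}})
            = {cyl_point k \<xi> t | \<xi> t. \<xi> \<in> B \<and> t \<in> {-r<..<\<phi> \<xi>}}))"

definition proj_set :: "'a::metric_space set \<Rightarrow> 'a \<Rightarrow> 'a set" where
  "proj_set A x = {y \<in> A. dist y x = infdist x A}"

definition Unp :: "'a::metric_space set \<Rightarrow> 'a set" where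
  "Unp A = {x. \<exists>!y. y \<in> proj_set A x}"

text \<open>Values in \<open>[0, \<infinity>]\<close>; the supremum of the empty set of radii is \<open>0\<close>.\<close>

definition reach_at :: "'a::metric_space set \<Rightarrow> 'a \<Rightarrow> ennreal" where
  "reach_at A a = Sup {ennreal r | r. r > 0 \<and> ball a r \<subseteq> Unp A}"

definition reach :: "'a::metric_space set \<Rightarrow> ennreal" where
  "reach A = (INF a\<in>A. reach_at A a)"

definition positive_reach :: "'a::metric_space set \<Rightarrow> bool" where
  "positive_reach A \<longleftrightarrow> reach A > 0"

end

theory Submission
  imports Defs "HOL-Complex_Analysis.Conformal_Mappings" "HOL-Computational_Algebra.Polynomial"
begin

text \<open>
  Why the theorem holds. Fix the center \<open>a\<close> of the star and let \<open>K\<close> be the closure of \<open>\<Omega>\<close>.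
  Every point of \<open>K\<close> lies on a segment from \<open>a\<close> to a boundary point \<open>y\<close>, so the mesh is sought as
  a product: about \<open>n\<close> Chebyshev-like parameters \<open>t\<close> on each segment, times a finite set
  of about \<open>n\<^sup>d\<^sup>-\<^sup>1\<close> boundary points. If \<open>p\<close> has degree \<open>n\<close> and \<open>\<bar>p\<bar> \<le> M\<close> on \<open>K\<close>, replacing \<open>t\<close> by the
  nearest parameter and then \<open>y\<close> by a suitable boundary point of the net changes the value of \<open>p\<close> by
  at most \<open>M/4\<close> each time. Applied at a point where \<open>\<bar>p\<bar>\<close> attains its maximum \<open>M\<close> this gives a
  mesh point with \<open>\<bar>p\<bar> \<ge> M/2\<close>, so the mesh has constant 2.

  Both replacements rest on one univariate fact, a Bernstein inequality for \<open>q (cos \<theta>)\<close>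
  (\<open>poly_cos_lipschitz\<close>). It handles the radial replacement at once. The replacement along the
  boundary is only needed on \<open>\<partial>\<Omega>\<close> itself: since \<open>\<Omega>\<close> is starlike, the homothety
  \<open>z \<mapsto> a + t (z - a)\<close> maps \<open>K\<close> into \<open>K\<close>, and composing \<open>p\<close> with it reduces the level \<open>t\<close> to the
  level \<open>1\<close> (\<open>starlike_mesh_estimate\<close>).

  On the boundary the positive reach of the complement enters through interior balls. Near
  the complement the nearest-point projection is single-valued and continuous, and Brouwer's theorem
  then shows that a projection ray can be prolonged up to the reach (\<open>projection_ray_extends\<close>).
  Hence every boundary point is touched from inside by a ball of a fixed radius \<open>r\<close> contained in
  \<open>\<Omega>\<close> (\<open>frontier_inner_ball\<close>). Inside such a ball runs a parabola that leaves the boundary point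
  in any prescribed tangential direction, so the Bernstein inequality bounds the tangential increments of \<open>p\<close>
  by a multiple of \<open>n M / r\<close> times the step (\<open>tangential_increment\<close>).

  The boundary is locally a Lipschitz graph, which may have corners, so there need not be a tangent to move along.
  The interior balls however support the graph from below by paraboloids of uniform curvature; the slopes
  of these paraboloids along a line are therefore increasing up to an error proportional to the step,
  and the deviations of the graph from its supporting slopes telescope. Letting the step
  tend to zero, only the tangential contribution remains (\<open>boundary_path_increment\<close>). So two
  boundary points of one chart over parameters at distance \<open>h\<close> have \<open>p\<close>-values that differ by at most a multiple
  of \<open>n h M\<close>, and a grid of mesh size proportional to \<open>1/n\<close> in each of finitely many charts is a
  sufficient boundary net (\<open>boundary_net\<close>).
\<close>

section \<open>Bernstein inequality for univariate polynomials\<close>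

lemma poly_of_real_map_poly:
  "poly (map_poly complex_of_real q) (of_real x) = of_real (poly q x)"
  by (induction q) (auto simp: map_poly_pCons)

text \<open>The analogue of the Bernstein--Walsh inequality after the substitution \<open>x = cos z\<close>. With \<open>w = exp (\<i> z)\<close>,
  the function \<open>w\<^sup>m q ((w + 1/w) / 2)\<close> is a polynomial in \<open>w\<close> that is bounded by \<open>M\<close> on the unit
  circle, hence on the unit disc, which corresponds to the upper half plane for \<open>z\<close>. The lower
  half plane follows as \<open>cos\<close> is even.\<close>

lemma poly_cos_growth:
  fixes q :: "real poly"
  assumes "degree q \<le> m" and bound: "\<And>x. \<bar>x\<bar> \<le> 1 \<Longrightarrow> \<bar>poly q x\<bar> \<le> M"
  shows "norm (poly (map_poly complex_of_real q) (cos z)) \<le> M * exp (real m * \<bar>Im z\<bar>)"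
proof -
  define Q where "Q = map_poly complex_of_real q"
  have Q_real: "poly Q (of_real x) = of_real (poly q x)" for x
    by (simp add: Q_def poly_of_real_map_poly)
  have deg: "degree Q \<le> m"
    using assms(1) by (simp add: Q_def degree_map_poly)
  \<comment> \<open>The polynomial \<open>w\<^sup>m Q ((w + 1/w) / 2)\<close>, written out so that it is defined at \<open>w = 0\<close> too.\<close>
  define F where "F w = (\<Sum>k\<le>degree Q. coeff Q k * ((w\<^sup>2 + 1) / 2) ^ k * w ^ (m - k))" for w
  have F_eq: "F w = w ^ m * poly Q ((w + 1 / w) / 2)" if "w \<noteq> 0" for w
  proof -
    have summand: "coeff Q k * ((w\<^sup>2 + 1) / 2) ^ k * w ^ (m - k) = w ^ m * (coeff Q k * ((w + 1 / w) / 2) ^ k)"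
      if "k \<le> degree Q" for k
    proof -
      have "(w\<^sup>2 + 1) / 2 = w * ((w + 1 / w) / 2)"
        using \<open>w \<noteq> 0\<close> by (simp add: field_simps power2_eq_square)
      then have "((w\<^sup>2 + 1) / 2) ^ k = w ^ k * ((w + 1 / w) / 2) ^ k"
        by (simp only: power_mult_distrib)
      moreover have "w ^ m = w ^ k * w ^ (m - k)"
        using that deg by (simp flip: power_add)
      ultimately show ?thesis
        by (simp only: mult_ac)
    qed
    show ?thesis
      unfolding F_def poly_altdef sum_distrib_left by (rule sum.cong[OF refl], rule summand) simp
  qed
  have F_hol: "F holomorphic_on A" for A
    unfolding F_def by (intro holomorphic_intros) auto
  have F_circle: "norm (F w) \<le> M" if "norm w = 1" for w
  proof -
    have "w \<noteq> 0"
      using that by auto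
    have "1 / w = cnj w"
      using that \<open>w \<noteq> 0\<close> complex_norm_square[of w] by (simp add: field_simps)
    then have "(w + 1 / w) / 2 = of_real (Re w)"
      by (simp add: complex_add_cnj)
    moreover have "\<bar>Re w\<bar> \<le> 1"
      using abs_Re_le_cmod[of w] that by simp
    ultimately show ?thesis
      using bound[of "Re w"] that
      by (simp add: F_eq[OF \<open>w \<noteq> 0\<close>] norm_mult norm_power Q_real)
  qed
  have F_disc: "norm (F w) \<le> M" if "norm w \<le> 1" for w
    by (rule maximum_modulus_frontier[of F "cball 0 1"])
      (use that F_circle in \<open>auto intro: F_hol holomorphic_on_imp_continuous_on\<close>)
  have upper: "norm (poly Q (cos z)) \<le> M * exp (real m * \<bar>Im z\<bar>)" if "Im z \<ge> 0" for z
  proof -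
    define w where "w = exp (\<i> * z)"
    have "w \<noteq> 0" and nw: "norm w = exp (- Im z)"
      by (simp_all add: w_def)
    have "cos z = (w + 1 / w) / 2"
      by (simp add: w_def cos_exp_eq exp_minus field_simps)
    then have "F w = w ^ m * poly Q (cos z)"
      using F_eq[OF \<open>w \<noteq> 0\<close>] by (simp only:)
    then have "exp (- Im z) ^ m * norm (poly Q (cos z)) \<le> M"
      using F_disc[of w] that nw by (simp add: norm_mult norm_power)
    moreover have "exp (- Im z) ^ m = inverse (exp (real m * Im z))"
      by (simp only: exp_minus exp_of_nat_mult power_inverse)
    ultimately show ?thesis
      using that by (simp add: field_simps)
  qed
  show ?thesis
    unfolding Q_def[symmetric] using upper[of z] upper[of "- z"] by (cases "Im z \<ge> 0") auto
qed

text \<open>Bernstein's inequality up to a constant factor: on a disc of radius \<open>1 / (m + 1)\<close> around a real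
  point the growth factor \<open>exp (m \<bar>Im z\<bar>)\<close> stays below \<open>3\<close>, and Cauchy's estimate bounds the derivative at the center.\<close>

lemma poly_cos_lipschitz:
  fixes q :: "real poly"
  assumes "degree q \<le> m" and bound: "\<And>x. \<bar>x\<bar> \<le> 1 \<Longrightarrow> \<bar>poly q x\<bar> \<le> M"
  shows "\<bar>poly q (cos a) - poly q (cos b)\<bar> \<le> 3 * real (m + 1) * M * \<bar>a - b\<bar>"
proof -
  define G where "G z = poly (map_poly complex_of_real q) (cos z)" for z
  have G_hol: "G holomorphic_on A" for A
    unfolding G_def poly_altdef by (intro holomorphic_intros)
  have G_real: "G (of_real t) = of_real (poly q (cos t))" for t
    unfolding G_def cos_of_real by (rule poly_of_real_map_poly)
  have M: "M \<ge> 0"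
    using bound[of 0] by simp
  have deriv_bound: "norm (deriv G (of_real t)) \<le> 3 * real (m + 1) * M" for t :: real
  proof -
    have "norm ((deriv ^^ 1) G (of_real t)) \<le> fact 1 * (3 * M) / (1 / real (m + 1)) ^ 1"
    proof (rule Cauchy_inequality)
      fix z :: complex
      assume z: "norm (of_real t - z) = 1 / real (m + 1)"
      have "\<bar>Im z\<bar> \<le> 1 / real (m + 1)"
        using abs_Im_le_cmod[of "of_real t - z"] z by simp
      then have "real m * \<bar>Im z\<bar> \<le> real m * (1 / real (m + 1))"
        by (intro mult_left_mono) auto
      also have "\<dots> \<le> 1"
        by (simp add: field_simps)
      finally have "exp (real m * \<bar>Im z\<bar>) \<le> 3"
        using exp_le by (meson exp_le_cancel_iff order_trans)
      then have "M * exp (real m * \<bar>Im z\<bar>) \<le> M * 3"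
        using M by (intro mult_left_mono)
      then show "norm (G z) \<le> 3 * M"
        using poly_cos_growth[OF assms, of z] unfolding G_def by simp
    qed (auto intro: G_hol holomorphic_on_imp_continuous_on)
    then show ?thesis
      by (simp add: mult_ac)
  qed
  have "norm (G (of_real a) - G (of_real b)) \<le> 3 * real (m + 1) * M * norm (complex_of_real a - of_real b)"
  proof (rule field_differentiable_bound[of \<real> G "deriv G"])
    show "convex (\<real> :: complex set)"
      by (rule convex_Reals)
    show "(G has_field_derivative deriv G z) (at z within \<real>)" if "z \<in> \<real>" for z
      by (rule has_field_derivative_at_within, rule holomorphic_derivI[OF G_hol[of UNIV]]) auto
    show "norm (deriv G z) \<le> 3 * real (m + 1) * M" if "z \<in> \<real>" for z
      using that deriv_bound by (auto elim!: Reals_cases)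
  qed auto
  then show ?thesis
    unfolding G_real of_real_diff[symmetric] norm_of_real .
qed

text \<open>Translates an increment of \<open>\<theta>\<close> near \<open>\<pi>/2\<close> into an increment of \<open>cos \<theta>\<close> near \<open>0\<close>; the factor \<open>4\<close> is
  crude but valid on the whole interval.\<close>

lemma arcsin_le_linear:
  assumes "\<bar>s\<bar> \<le> 1"
  shows "\<bar>arcsin s\<bar> \<le> 4 * \<bar>s\<bar>"
proof (cases "\<bar>s\<bar> \<le> 1 / 2")
  case True
  define t where "t = arcsin s"
  have s: "sin t = s"
    using assms by (simp add: t_def abs_le_iff)
  have t: "\<bar>t\<bar> < pi / 2"
    using True arcsin_lt_bounded[of s] unfolding t_def by linarith
  have "cos t \<ge> 1 / 2"
  proof -
    have "s\<^sup>2 \<le> (1 / 2)\<^sup>2"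
      using True by (simp add: abs_le_square_iff[symmetric])
    then have "(1 / 2)\<^sup>2 \<le> (cos t)\<^sup>2"
      using sin_cos_squared_add[of t] s by (simp add: power2_eq_square)
    moreover have "cos t > 0"
      using t by (intro cos_gt_zero_pi) auto
    ultimately show ?thesis
      using power2_le_imp_le less_imp_le by blast
  qed
  have "\<bar>t\<bar> \<le> \<bar>tan t\<bar>"
    using t by (rule abs_tan_ge)
  also have "\<dots> = \<bar>s\<bar> / cos t"
    using \<open>cos t \<ge> 1 / 2\<close> s by (simp add: tan_def abs_divide)
  also have "\<dots> \<le> \<bar>s\<bar> / (1 / 2)"
    using \<open>cos t \<ge> 1 / 2\<close> by (intro divide_left_mono) auto
  finally show ?thesis
    unfolding t_def by simp
next
  case False
  then show ?thesis
    using arcsin_bounded[of s] assms pi_less_4 by (auto simp: abs_if split: if_splits)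
qed

section \<open>Polynomials restricted to parabolas\<close>

text \<open>What the proof uses of a polynomial of degree at most \<open>n\<close>: its restriction to any (possibly degenerate)
  parabola is univariate of degree at most \<open>2 n\<close>. Unlike coefficient representations, this property is visibly
  preserved by homotheties.\<close>

definition poly_on_parabolas :: "nat \<Rightarrow> ('a::euclidean_space \<Rightarrow> real) \<Rightarrow> bool" where
  "poly_on_parabolas n p \<longleftrightarrow> continuous_on UNIV p \<and>
     (\<forall>x u w. \<exists>q. degree q \<le> 2 * n \<and> (\<forall>s. p (x + s *\<^sub>R u + s\<^sup>2 *\<^sub>R w) = poly q s))"

lemma poly_on_parabolas_polys:
  assumes "p \<in> polys n"
  shows "poly_on_parabolas n p"
proof -
  obtain c where p: "p = (\<lambda>x. \<Sum>\<alpha> | sum \<alpha> UNIV \<le> n. c \<alpha> * (\<Prod>i\<in>UNIV. (x $ i) ^ \<alpha> i))"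
    using assms by (auto simp: polys_def)
  have "\<exists>q. degree q \<le> 2 * n \<and> (\<forall>s. p (x + s *\<^sub>R u + s\<^sup>2 *\<^sub>R w) = poly q s)" for x u w
  proof (intro exI conjI allI)
    define f where "f \<alpha> = (\<Prod>i\<in>UNIV. [:x $ i, u $ i, w $ i:] ^ \<alpha> i)" for \<alpha>
    define q where "q = (\<Sum>\<alpha> | sum \<alpha> UNIV \<le> n. smult (c \<alpha>) (f \<alpha>))"
    have deg: "degree (f \<alpha>) \<le> 2 * n" if "sum \<alpha> UNIV \<le> n" for \<alpha>
    proof -
      have "degree (f \<alpha>) \<le> (\<Sum>i\<in>UNIV. degree ([:x $ i, u $ i, w $ i:] ^ \<alpha> i))"
        unfolding f_def by (rule order_trans[OF degree_prod_sum_le]) auto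
      also have "\<dots> \<le> (\<Sum>i\<in>UNIV. 2 * \<alpha> i)"
        by (intro sum_mono order_trans[OF degree_power_le] mult_right_mono) auto
      also have "\<dots> \<le> 2 * n"
        using that by (simp flip: sum_distrib_left)
      finally show ?thesis .
    qed
    show "degree q \<le> 2 * n"
      unfolding q_def
      by (intro degree_sum_le finite_exponents order_trans[OF degree_smult_le]) (use deg in auto)
    show "p (x + s *\<^sub>R u + s\<^sup>2 *\<^sub>R w) = poly q s" for s
      by (simp add: p q_def f_def poly_sum poly_prod poly_power power2_eq_square algebra_simps)
  qed
  moreover have "continuous_on UNIV p"
    unfolding p by (intro continuous_intros)
  ultimately show ?thesis
    by (simp add: poly_on_parabolas_def)
qed

lemma poly_on_parabolas_homothety:
  assumes "poly_on_parabolas n p"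
  shows "poly_on_parabolas n (\<lambda>x. p (a + t *\<^sub>R (x - a)))"
  unfolding poly_on_parabolas_def
proof (intro conjI allI)
  have "continuous_on UNIV p"
    using assms by (simp add: poly_on_parabolas_def)
  then show "continuous_on UNIV (\<lambda>x. p (a + t *\<^sub>R (x - a)))"
    by (rule continuous_on_compose2) (auto intro!: continuous_intros)
  fix x u w
  obtain q where "degree q \<le> 2 * n"
    and q: "\<And>s. p ((a + t *\<^sub>R (x - a)) + s *\<^sub>R (t *\<^sub>R u) + s\<^sup>2 *\<^sub>R (t *\<^sub>R w)) = poly q s"
    using assms unfolding poly_on_parabolas_def by blast
  moreover have "p (a + t *\<^sub>R (x + s *\<^sub>R u + s\<^sup>2 *\<^sub>R w - a)) = poly q s" for s
    unfolding q[symmetric] by (simp add: algebra_simps)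
  ultimately show "\<exists>q. degree q \<le> 2 * n \<and> (\<forall>s. p (a + t *\<^sub>R (x + s *\<^sub>R u + s\<^sup>2 *\<^sub>R w - a)) = poly q s)"
    by blast
qed

lemma parabola_cos_increment:
  assumes "poly_on_parabolas n p"
    and bound: "\<And>s. \<bar>s\<bar> \<le> 1 \<Longrightarrow> \<bar>p (x + s *\<^sub>R u + s\<^sup>2 *\<^sub>R w)\<bar> \<le> M"
  shows "\<bar>p (x + cos a *\<^sub>R u + (cos a)\<^sup>2 *\<^sub>R w) - p (x + cos b *\<^sub>R u + (cos b)\<^sup>2 *\<^sub>R w)\<bar>
    \<le> 3 * real (2 * n + 1) * M * \<bar>a - b\<bar>"
proof -
  obtain q where "degree q \<le> 2 * n" and q: "\<And>s. p (x + s *\<^sub>R u + s\<^sup>2 *\<^sub>R w) = poly q s"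
    using assms(1) unfolding poly_on_parabolas_def by blast
  then show ?thesis
    using poly_cos_lipschitz[of q "2 * n" M a b] bound by (simp only: q)
qed

text \<open>At the vertex \<open>s = 0\<close>, in the middle of the parameter interval, Bernstein's inequality costs a factor proportional to
  \<open>n\<close>, and not \<open>n\<^sup>2\<close> as at the ends.\<close>

lemma parabola_increment:
  assumes "poly_on_parabolas n p"
    and bound: "\<And>s. \<bar>s\<bar> \<le> 1 \<Longrightarrow> \<bar>p (x + s *\<^sub>R u + s\<^sup>2 *\<^sub>R w)\<bar> \<le> M"
    and "\<bar>s\<bar> \<le> 1"
  shows "\<bar>p (x + s *\<^sub>R u + s\<^sup>2 *\<^sub>R w) - p x\<bar> \<le> 12 * real (2 * n + 1) * M * \<bar>s\<bar>"
proof -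
  have M: "M \<ge> 0"
    using bound[of 0] by simp
  have "\<bar>p (x + s *\<^sub>R u + s\<^sup>2 *\<^sub>R w) - p x\<bar> \<le> 3 * real (2 * n + 1) * M * \<bar>arccos s - pi / 2\<bar>"
    using parabola_cos_increment[OF assms(1) bound, of "arccos s" "pi / 2"] assms(3) by (simp add: abs_le_iff)
  also have "\<bar>arccos s - pi / 2\<bar> = \<bar>arcsin s\<bar>"
    using assms(3) arccos_arcsin_eq[of s] by (simp add: abs_le_iff)
  also have "3 * real (2 * n + 1) * M * \<bar>arcsin s\<bar> \<le> 3 * real (2 * n + 1) * M * (4 * \<bar>s\<bar>)"
    using arcsin_le_linear[OF assms(3)] M by (intro mult_left_mono) auto
  also have "\<dots> = 12 * real (2 * n + 1) * M * \<bar>s\<bar>"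
    by simp
  finally show ?thesis .
qed

section \<open>Positive reach of the complement and interior balls\<close>

lemma proj_set_nonempty:
  fixes C :: "'a::euclidean_space set"
  assumes "closed C" "C \<noteq> {}"
  obtains y where "y \<in> proj_set C x"
proof -
  obtain y where "y \<in> C" "infdist x C = dist x y"
    using infdist_attains_inf[OF assms] by blast
  then show ?thesis
    using that by (auto simp: proj_set_def dist_commute)
qed

lemma Unp_proj_set_eq:
  assumes "x \<in> Unp C" "y \<in> proj_set C x" "z \<in> proj_set C x"
  shows "y = z"
  using assms by (auto simp: Unp_def)

text \<open>By the triangle inequality: a point of \<open>C\<close> closer to \<open>z\<close> than \<open>b\<close> would also be closer to \<open>y\<close>.\<close>

lemma proj_set_towards_foot:
  fixes C :: "'a::euclidean_space set"
  assumes "b \<in> proj_set C y" "z \<in> closed_segment b y"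
  shows "b \<in> proj_set C z"
proof -
  have b: "b \<in> C" "dist b y = infdist y C"
    using assms(1) by (auto simp: proj_set_def)
  have "dist b z + dist z y = dist b y"
    using assms(2) between[of b y z] by (auto simp: between_mem_segment)
  then have "dist b z \<le> infdist z C"
    using b infdist_triangle[of y C z] by (simp add: dist_commute)
  moreover have "infdist z C \<le> dist b z"
    using infdist_le[OF b(1), of z] by (simp add: dist_commute)
  ultimately show ?thesis
    using b(1) by (auto simp: proj_set_def)
qed

text \<open>A function with compact target and closed graph is continuous. The graph of the projection is closed because, where the foot is
  unique, it is described by the closed conditions \<open>b \<in> C\<close> and \<open>dist b x = infdist x C\<close>.\<close>

lemma continuous_on_projection:
  fixes C :: "'a::euclidean_space set"
  assumes "closed C" "bounded D" "D \<subseteq> Unp C"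
    and proj: "\<And>x. x \<in> D \<Longrightarrow> P x \<in> proj_set C x"
  shows "continuous_on D P"
proof (cases "D = {}")
  case False
  then obtain x0 where x0: "x0 \<in> D"
    by blast
  obtain e where e: "\<And>x. x \<in> D \<Longrightarrow> dist x0 x \<le> e"
    using \<open>bounded D\<close> bounded_any_center[of D x0] by blast
  define T where "T = cball x0 (infdist x0 C + 2 * e)"
  have "P \<in> D \<rightarrow> T"
  proof
    fix x assume x: "x \<in> D"
    have "dist x0 (P x) \<le> dist x0 x + dist (P x) x"
      by (metis dist_commute dist_triangle)
    also have "dist (P x) x = infdist x C"
      using proj[OF x] by (simp add: proj_set_def)
    also have "infdist x C \<le> infdist x0 C + dist x0 x"
      using infdist_triangle[of x C x0] by (simp add: dist_commute)
    finally show "P x \<in> T"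
      using e[OF x] by (simp add: T_def)
  qed
  moreover have "closedin (top_of_set (D \<times> T)) ((\<lambda>x. (x, P x)) ` D)"
  proof -
    have "(\<lambda>x. (x, P x)) ` D = (D \<times> T) \<inter> {z. snd z \<in> C \<and> dist (snd z) (fst z) = infdist (fst z) C}"
    proof (intro equalityI subsetI)
      fix z assume "z \<in> (\<lambda>x. (x, P x)) ` D"
      then show "z \<in> (D \<times> T) \<inter> {z. snd z \<in> C \<and> dist (snd z) (fst z) = infdist (fst z) C}"
        using \<open>P \<in> D \<rightarrow> T\<close> proj by (auto simp: proj_set_def)
    next
      fix z assume z: "z \<in> (D \<times> T) \<inter> {z. snd z \<in> C \<and> dist (snd z) (fst z) = infdist (fst z) C}"
      then have "z = (fst z, P (fst z))" "fst z \<in> D"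
        using Unp_proj_set_eq[of "fst z" C] proj[of "fst z"] \<open>D \<subseteq> Unp C\<close> by (auto simp: proj_set_def prod_eq_iff)
      then show "z \<in> (\<lambda>x. (x, P x)) ` D"
        by (rule image_eqI)
    qed
    moreover have "closed {z. snd z \<in> C \<and> dist (snd z) (fst z) = infdist (fst z) C}"
      unfolding Collect_conj_eq using \<open>closed C\<close>
      by (intro closed_Int closed_Collect_eq continuous_intros closed_vimage_snd[unfolded vimage_def])
    ultimately show ?thesis
      by (simp add: closedin_closed_Int)
  qed
  ultimately show ?thesis
    using continuous_closed_graph_eq[of T P D] by (simp add: T_def)
qed auto

text \<open>The key consequence of unique projections. Send \<open>y\<close> in the closed ball around \<open>x\<close> to the point of the sphere
  that is opposite, as seen from \<open>x\<close>, to the foot of \<open>y\<close>. By Brouwer's theorem there is a fixed point \<open>y\<close>; then \<open>x\<close> lies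
  between \<open>y\<close> and its foot, so \<open>x\<close> and \<open>y\<close> have the same foot \<open>a\<close>, and \<open>y\<close> is the prolongation of the ray from \<open>a\<close> through \<open>x\<close>.\<close>

lemma projection_ray_extends:
  fixes C :: "'a::euclidean_space set"
  assumes "closed C" "x \<notin> C" "a \<in> proj_set C x" "0 < e" "cball x e \<subseteq> Unp C"
  shows "a \<in> proj_set C (x + (e / norm (x - a)) *\<^sub>R (x - a))"
proof -
  have "C \<noteq> {}"
    using assms(3) by (auto simp: proj_set_def)
  then have "\<forall>y. \<exists>b. b \<in> proj_set C y"
    using proj_set_nonempty[OF \<open>closed C\<close>] by metis
  then obtain P where P: "\<And>y. P y \<in> proj_set C y"
    by metis
  have ne: "x - P y \<noteq> 0" for y
    using P[of y] \<open>x \<notin> C\<close> by (auto simp: proj_set_def)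
  \<comment> \<open>The point of the sphere opposite to the foot of \<open>y\<close>.\<close>
  define f where "f y = x + (e / norm (x - P y)) *\<^sub>R (x - P y)" for y
  have "continuous_on (cball x e) P"
    using assms P by (intro continuous_on_projection) auto
  then have "continuous_on (cball x e) f"
    unfolding f_def using ne by (intro continuous_intros) auto
  moreover have "f \<in> cball x e \<rightarrow> cball x e"
    using ne \<open>0 < e\<close> by (auto simp: f_def dist_norm)
  ultimately obtain y where y: "y \<in> cball x e" "f y = y"
    using brouwer_ball[OF \<open>0 < e\<close>] by metis
  define l where "l = norm (x - P y)"
  have l: "l > 0"
    using ne[of y] by (simp add: l_def)
  have y_eq: "y = x + (e / l) *\<^sub>R (x - P y)"
    unfolding l_def f_def[symmetric] by (rule y(2)[symmetric])
  \<comment> \<open>The fixed point exhibits \<open>x\<close> as a convex combination of \<open>P y\<close> and \<open>y\<close>.\<close>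
  have "x = (1 - l / (l + e)) *\<^sub>R P y + (l / (l + e)) *\<^sub>R y"
  proof -
    have "(l + e) *\<^sub>R x = e *\<^sub>R P y + l *\<^sub>R y"
    proof -
      have "l *\<^sub>R y = l *\<^sub>R x + e *\<^sub>R (x - P y)"
        using arg_cong[OF y_eq, of "\<lambda>z. l *\<^sub>R z"] l by (simp add: scaleR_add_right)
      then show ?thesis
        by (simp add: algebra_simps)
    qed
    then have "(1 / (l + e)) *\<^sub>R ((l + e) *\<^sub>R x) = (1 / (l + e)) *\<^sub>R (e *\<^sub>R P y + l *\<^sub>R y)"
      by simp
    moreover have "1 - l / (l + e) = e / (l + e)"
      using l \<open>0 < e\<close> by (simp add: field_simps)
    ultimately show ?thesis
      using l \<open>0 < e\<close> by (simp add: scaleR_add_right)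
  qed
  then have "x \<in> closed_segment (P y) y"
    using l \<open>0 < e\<close> unfolding closed_segment_def by (intro CollectI exI[of _ "l / (l + e)"]) auto
  then have "P y \<in> proj_set C x"
    using proj_set_towards_foot[OF P] by blast
  moreover have "x \<in> Unp C"
    using assms(4,5) by auto
  ultimately have "P y = a"
    using Unp_proj_set_eq assms(3) by metis
  moreover have "x + (e / norm (x - P y)) *\<^sub>R (x - P y) = y"
    using y(2) unfolding f_def .
  ultimately show ?thesis
    using P[of y] by simp
qed

text \<open>One prolongation by \<open>r - \<bar>x - a\<bar>\<close> reaches the point at distance \<open>r\<close> from \<open>a\<close>, and \<open>a\<close> is still its foot.\<close>

lemma inner_ball_along_normal:
  fixes C :: "'a::euclidean_space set"
  assumes "closed C" "ball a R \<subseteq> Unp C" "0 < r" "r < R"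
    and "x \<notin> C" "a \<in> proj_set C x" "dist a x < r"
  shows "ball (a + (r / norm (x - a)) *\<^sub>R (x - a)) r \<inter> C = {}"
proof -
  define l where "l = norm (x - a)"
  have "a \<in> C"
    using assms(6) by (simp add: proj_set_def)
  then have l: "l > 0" "l < r"
    using assms(5,7) by (auto simp: l_def dist_norm norm_minus_commute)
  define c where "c = x + ((r - l) / l) *\<^sub>R (x - a)"
  have "cball x (r - l) \<subseteq> ball a R"
  proof
    fix z assume "z \<in> cball x (r - l)"
    then have "dist a z \<le> l + (r - l)"
      using dist_triangle[of a z x] by (simp add: l_def dist_norm norm_minus_commute)
    then show "z \<in> ball a R"
      using \<open>r < R\<close> by simp
  qed
  then have "a \<in> proj_set C c"
    unfolding c_def l_def using assms l by (intro projection_ray_extends) (auto simp: l_def)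
  moreover have c: "c = a + (r / l) *\<^sub>R (x - a)"
  proof -
    have "(r - l) / l = r / l - 1"
      using l by (simp add: field_simps)
    show ?thesis
      unfolding c_def \<open>(r - l) / l = r / l - 1\<close> by (simp add: algebra_simps)
  qed
  moreover have "dist a c = r"
    using l \<open>0 < r\<close> by (simp add: c dist_norm l_def)
  ultimately have "infdist c C = r"
    by (simp add: proj_set_def)
  then have "ball c r \<inter> C = {}"
    using infdist_le[of _ C c] by (auto simp: not_less[symmetric])
  then show ?thesis
    unfolding c l_def .
qed

text \<open>Approximate \<open>y\<close> by points of \<open>\<Omega>\<close>, whose feet tend to \<open>y\<close>, and pass to a limit of the normal directions by compactness
  of the sphere.\<close>

lemma frontier_inner_ball:
  fixes \<Omega> :: "'a::euclidean_space set"
  assumes "open \<Omega>" and reach: "\<And>a. a \<notin> \<Omega> \<Longrightarrow> ball a R \<subseteq> Unp (- \<Omega>)"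
    and "0 < r" "r < R" and y: "y \<in> frontier \<Omega>"
  obtains \<nu> where "norm \<nu> = 1" "ball (y + r *\<^sub>R \<nu>) r \<subseteq> \<Omega>"
proof -
  have "y \<notin> \<Omega>"
    using y \<open>open \<Omega>\<close> by (simp add: frontier_def interior_open)
  have "y \<in> closure \<Omega>"
    using y by (simp add: frontier_def)
  then obtain x where x: "\<And>k. x k \<in> \<Omega>" "x \<longlonglongrightarrow> y"
    by (meson closure_sequential)
  have "\<forall>k. \<exists>b. b \<in> proj_set (- \<Omega>) (x k)"
    using proj_set_nonempty[of "- \<Omega>"] \<open>y \<notin> \<Omega>\<close> \<open>open \<Omega>\<close> by (metis Compl_iff closed_Compl empty_iff)
  then obtain b where b: "\<And>k. b k \<in> proj_set (- \<Omega>) (x k)"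
    by metis
  have b_notin: "b k \<notin> \<Omega>" for k
    using b[of k] by (simp add: proj_set_def)
  have b_le: "dist (b k) (x k) \<le> dist (x k) y" for k
    using b[of k] infdist_le[of y "- \<Omega>" "x k"] \<open>y \<notin> \<Omega>\<close> by (simp add: proj_set_def)
  have dxy: "(\<lambda>k. dist (x k) y) \<longlonglongrightarrow> 0"
    using x(2) tendsto_dist_iff by blast
  have dbx: "(\<lambda>k. dist (b k) (x k)) \<longlonglongrightarrow> 0"
    by (rule tendsto_sandwich[OF _ _ tendsto_const dxy]) (use b_le in auto)
  have b_lim: "b \<longlonglongrightarrow> y"
  proof -
    have "(\<lambda>k. dist (b k) y) \<longlonglongrightarrow> 0"
    proof (rule tendsto_sandwich[OF _ _ tendsto_const])
      show "(\<lambda>k. dist (b k) (x k) + dist (x k) y) \<longlonglongrightarrow> 0"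
        using tendsto_add[OF dbx dxy] by simp
    qed (auto simp: dist_triangle)
    then show ?thesis
      using tendsto_dist_iff by blast
  qed
  define v where "v k = (1 / norm (x k - b k)) *\<^sub>R (x k - b k)" for k
  have "v k \<in> sphere 0 1" for k
    using x(1)[of k] b_notin[of k] by (auto simp: v_def)
  then obtain \<nu> \<sigma> where \<nu>: "\<nu> \<in> sphere 0 1" and \<sigma>: "strict_mono \<sigma>" and lim: "(v \<circ> \<sigma>) \<longlonglongrightarrow> \<nu>"
    using compact_sphere[of "0 :: 'a" 1] unfolding compact_def by blast
  have "ball (y + r *\<^sub>R \<nu>) r \<subseteq> \<Omega>"
  proof
    fix z assume "z \<in> ball (y + r *\<^sub>R \<nu>) r"
    then have "dist (y + r *\<^sub>R \<nu>) z < r"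
      by simp
    moreover have "(\<lambda>k. dist (b (\<sigma> k) + r *\<^sub>R v (\<sigma> k)) z) \<longlonglongrightarrow> dist (y + r *\<^sub>R \<nu>) z"
      using LIMSEQ_subseq_LIMSEQ[OF b_lim \<sigma>] lim by (intro tendsto_intros) (auto simp: comp_def)
    ultimately have "\<forall>\<^sub>F k in sequentially. dist (b (\<sigma> k) + r *\<^sub>R v (\<sigma> k)) z < r"
      by (rule order_tendstoD(2)[rotated])
    moreover have "\<forall>\<^sub>F k in sequentially. dist (b (\<sigma> k)) (x (\<sigma> k)) < r"
      using LIMSEQ_subseq_LIMSEQ[OF dbx \<sigma>] \<open>0 < r\<close> by (auto simp: comp_def intro: order_tendstoD(2))
    ultimately have "\<forall>\<^sub>F k in sequentially. z \<in> \<Omega>"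
    proof eventually_elim
      case (elim k)
      then have "ball (b (\<sigma> k) + r *\<^sub>R v (\<sigma> k)) r \<inter> - \<Omega> = {}"
        using inner_ball_along_normal[of "- \<Omega>" "b (\<sigma> k)" R r "x (\<sigma> k)"] b x(1) b_notin reach assms(1,3,4)
        by (simp add: v_def closed_Compl)
      then show ?case
        using elim(1) by auto
    qed
    then show "z \<in> \<Omega>"
      by simp
  qed
  then show ?thesis
    using \<nu> by (intro that) auto
qed

lemma positive_reach_uniform:
  assumes "positive_reach A"
  obtains r where "0 < r" "\<And>a. a \<in> A \<Longrightarrow> ball a r \<subseteq> Unp A"
proof -
  have "0 < reach A"
    using assms by (simp add: positive_reach_def)
  then obtain e where e: "0 < e" "e < reach A"
    using dense by blast
  then obtain r where r: "e = ennreal r" "0 < r"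
    by (cases e) (auto simp: top_unique)
  show ?thesis
  proof
    fix a assume "a \<in> A"
    then have "e < reach_at A a"
      using e(2) unfolding reach_def by (meson INF_lower less_le_trans)
    then obtain s where "s > 0" "ball a s \<subseteq> Unp A" "ennreal r < ennreal s"
      unfolding reach_at_def less_Sup_iff r by auto
    moreover have "r \<le> s"
      using \<open>ennreal r < ennreal s\<close> r(2) by (simp add: ennreal_less_iff)
    ultimately show "ball a r \<subseteq> Unp A"
      by (meson subset_ball order_trans)
  qed (rule r(2))
qed

section \<open>Increments of polynomials along the boundary\<close>

text \<open>The constant depends on \<open>p\<close>; it only serves to absorb error terms that vanish as the step of a subdivision tends to
  zero.\<close>

lemma poly_on_parabolas_locally_lipschitz:
  fixes p :: "'a::euclidean_space \<Rightarrow> real"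
  assumes p: "poly_on_parabolas n p" and "bounded S"
  obtains \<Lambda> where "\<Lambda> \<ge> 0" "\<And>x y. x \<in> S \<Longrightarrow> y \<in> S \<Longrightarrow> \<bar>p x - p y\<bar> \<le> \<Lambda> * norm (x - y)"
proof -
  obtain \<rho> where \<rho>: "\<rho> > 0" "S \<subseteq> cball 0 \<rho>"
    using \<open>bounded S\<close> unfolding bounded_pos by (auto simp: subset_iff)
  have "compact (p ` cball 0 (3 * \<rho>))"
    using p by (intro compact_continuous_image) (auto simp: poly_on_parabolas_def intro: continuous_on_subset)
  then obtain M where M: "\<And>x. x \<in> cball 0 (3 * \<rho>) \<Longrightarrow> \<bar>p x\<bar> \<le> M"
    by (metis bounded_iff compact_imp_bounded imageI real_norm_def)
  have "M \<ge> 0"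
    using M[of 0] \<rho> by simp
  show ?thesis
  proof
    show "0 \<le> 12 * real (2 * n + 1) * M / (2 * \<rho>)"
      using \<open>M \<ge> 0\<close> \<rho> by simp
    fix x y assume xy: "x \<in> S" "y \<in> S"
    show "\<bar>p x - p y\<bar> \<le> 12 * real (2 * n + 1) * M / (2 * \<rho>) * norm (x - y)"
    proof (cases "x = y")
      case False
      define l where "l = norm (x - y)"
      define u where "u = (2 * \<rho> / l) *\<^sub>R (x - y)"
      have "norm x \<le> \<rho>" "norm y \<le> \<rho>"
        using \<rho>(2) xy by auto
      then have l: "l > 0" "l \<le> 2 * \<rho>"
        using False norm_triangle_ineq4[of x y] by (simp_all add: l_def)
      have nu: "norm u = 2 * \<rho>"
        using l \<rho> by (simp add: u_def flip: l_def)
      have "\<bar>p (y + s *\<^sub>R u + s\<^sup>2 *\<^sub>R 0)\<bar> \<le> M" if "\<bar>s\<bar> \<le> 1" for s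
      proof -
        have "norm (y + s *\<^sub>R u) \<le> \<rho> + \<bar>s\<bar> * (2 * \<rho>)"
          using xy \<rho>(2) nu norm_triangle_ineq[of y "s *\<^sub>R u"] by fastforce
        also have "\<dots> \<le> \<rho> + 1 * (2 * \<rho>)"
          using that \<rho> by (intro add_left_mono mult_right_mono) auto
        finally show ?thesis
          using M[of "y + s *\<^sub>R u"] by simp
      qed
      from parabola_increment[OF p this, of "l / (2 * \<rho>)"] l \<rho>
      have "\<bar>p (y + (l / (2 * \<rho>)) *\<^sub>R u) - p y\<bar> \<le> 12 * real (2 * n + 1) * M * (l / (2 * \<rho>))"
        by simp
      moreover have "y + (l / (2 * \<rho>)) *\<^sub>R u = x"
        using l \<rho> by (simp add: u_def)
      ultimately show ?thesis
        by (simp add: l_def)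
    qed simp
  qed
qed

text \<open>The parabola with vertex \<open>y\<close>, tangent \<open>\<tau>\<close> and axis \<open>\<nu>\<close> whose parameter range \<open>[-1, 1]\<close> corresponds to
  tangential displacements up to \<open>r\<close> stays in the ball touching at \<open>y\<close>. So the increment of \<open>p\<close>
  in tangential directions is controlled without any loss from the curvature of the sphere.\<close>

lemma tangential_increment:
  fixes p :: "'a::euclidean_space \<Rightarrow> real"
  assumes p: "poly_on_parabolas n p" and bound: "\<And>x. x \<in> K \<Longrightarrow> \<bar>p x\<bar> \<le> M"
    and K: "cball (y + r *\<^sub>R \<nu>) r \<subseteq> K" and "0 < r" and "norm \<nu> = 1"
    and "\<tau> \<bullet> \<nu> = 0" and "norm \<tau> \<le> r"
  shows "\<bar>p (y + \<tau> + ((norm \<tau>)\<^sup>2 / r) *\<^sub>R \<nu>) - p y\<bar> \<le> 12 * real (2 * n + 1) * M * (norm \<tau> / r)"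
proof (cases "\<tau> = 0")
  case False
  define l where "l = norm \<tau>"
  have l: "l > 0" "l \<le> r"
    using False assms(7) by (auto simp: l_def)
  define u where "u = (r / l) *\<^sub>R \<tau>"
  have nu: "norm u = r"
    using l \<open>0 < r\<close> by (simp add: u_def flip: l_def)
  have "\<bar>p (y + s *\<^sub>R u + s\<^sup>2 *\<^sub>R (r *\<^sub>R \<nu>))\<bar> \<le> M" if "\<bar>s\<bar> \<le> 1" for s
  proof -
    \<comment> \<open>The vector from the point of the parabola to the center of the ball, split into its normal and tangential parts.\<close>
    have orth: "orthogonal (((1 - s\<^sup>2) * r) *\<^sub>R \<nu>) ((- s) *\<^sub>R u)"
      using assms(6) by (simp add: orthogonal_def u_def inner_commute)
    have "s\<^sup>2 \<le> 1"
      using that by (simp add: abs_square_le_1)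
    then have s4: "s\<^sup>2 * s\<^sup>2 \<le> s\<^sup>2 * 1"
      by (intro mult_left_mono) auto
    have "(norm (((1 - s\<^sup>2) * r) *\<^sub>R \<nu> + (- s) *\<^sub>R u))\<^sup>2 = ((1 - s\<^sup>2) * r)\<^sup>2 + (s * r)\<^sup>2"
      unfolding norm_add_Pythagorean[OF orth] using \<open>norm \<nu> = 1\<close> nu
      by (simp add: power_mult_distrib)
    also have "\<dots> = (1 - s\<^sup>2 + s\<^sup>2 * s\<^sup>2) * r\<^sup>2"
      by (simp add: power2_eq_square algebra_simps)
    also have "\<dots> \<le> 1 * r\<^sup>2"
      using s4 by (intro mult_right_mono) auto
    also have "\<dots> = r\<^sup>2"
      by simp
    finally have "norm (((1 - s\<^sup>2) * r) *\<^sub>R \<nu> + (- s) *\<^sub>R u) \<le> r"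
      by (rule power2_le_imp_le) (use \<open>0 < r\<close> in simp)
    moreover have "((1 - s\<^sup>2) * r) *\<^sub>R \<nu> + (- s) *\<^sub>R u = (y + r *\<^sub>R \<nu>) - (y + s *\<^sub>R u + s\<^sup>2 *\<^sub>R (r *\<^sub>R \<nu>))"
      by (simp add: scaleR_diff_left left_diff_distrib)
    ultimately have "y + s *\<^sub>R u + s\<^sup>2 *\<^sub>R (r *\<^sub>R \<nu>) \<in> cball (y + r *\<^sub>R \<nu>) r"
      by (simp only: mem_cball dist_norm)
    then show ?thesis
      using K bound by blast
  qed
  from parabola_increment[OF p this, of "l / r"] l
  have "\<bar>p (y + (l / r) *\<^sub>R u + (l / r)\<^sup>2 *\<^sub>R (r *\<^sub>R \<nu>)) - p y\<bar> \<le> 12 * real (2 * n + 1) * M * (l / r)"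
    by simp
  moreover have "(l / r) *\<^sub>R u = \<tau>"
    using l \<open>0 < r\<close> by (simp add: u_def)
  moreover have "(l / r)\<^sup>2 * r = l\<^sup>2 / r"
    using \<open>0 < r\<close> by (simp add: power2_eq_square)
  then have "(l / r)\<^sup>2 *\<^sub>R (r *\<^sub>R \<nu>) = (l\<^sup>2 / r) *\<^sub>R \<nu>"
    by (simp only: scaleR_scaleR)
  ultimately show ?thesis
    unfolding l_def[symmetric] by (simp only:)
qed simp

text \<open>A Lipschitz curve over a line in the boundary, each of whose points is touched by an interior ball with normal \<open>\<nu>\<close>
  transversal to the vertical \<open>E\<close>. The next point of the curve is outside the ball, so \<open>g\<close> lies above a parabola of slope \<open>m\<close>,
  where \<open>U + m E\<close> is orthogonal to \<open>\<nu>\<close>. Using this at both ends of a step \<open>h\<close> from \<open>s\<close> to \<open>t\<close> gives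
  \<open>m s h - O(h\<^sup>2) \<le> g t - g s \<le> m t h + O(h\<^sup>2)\<close>. Thus the step is tangential up to an error \<open>h (m t - m s) + O(h\<^sup>2)\<close>, and
  these errors add up to \<open>O(h)\<close> since the slopes are bounded and the first terms telescope.\<close>

lemma boundary_path_increment:
  fixes p :: "'a::euclidean_space \<Rightarrow> real" and g :: "real \<Rightarrow> real"
  assumes p: "poly_on_parabolas n p" and bound: "\<And>x. x \<in> closure \<Omega> \<Longrightarrow> \<bar>p x\<bar> \<le> M"
    and r: "0 < r" and \<kappa>: "0 < \<kappa>" and E: "norm E = 1"
    and lip: "\<And>s t. s \<in> {0..1} \<Longrightarrow> t \<in> {0..1} \<Longrightarrow> \<bar>g s - g t\<bar> \<le> L * \<bar>s - t\<bar>"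
    and outside: "\<And>s. s \<in> {0..1} \<Longrightarrow> P + s *\<^sub>R U + g s *\<^sub>R E \<notin> \<Omega>"
    and inner: "\<And>s. s \<in> {0..1} \<Longrightarrow> \<exists>\<nu>. norm \<nu> = 1 \<and> \<nu> \<bullet> E \<le> - \<kappa> \<and>
      ball (P + s *\<^sub>R U + g s *\<^sub>R E + r *\<^sub>R \<nu>) r \<subseteq> \<Omega>"
  shows "\<bar>p (P + U + g 1 *\<^sub>R E) - p (P + g 0 *\<^sub>R E)\<bar>
    \<le> 12 * real (2 * n + 1) * M * ((1 + 1 / \<kappa>) * norm U / r)"
proof -
  define \<gamma> where "\<gamma> s = P + s *\<^sub>R U + g s *\<^sub>R E" for s
  obtain \<nu> where nu: "\<And>s. s \<in> {0..1} \<Longrightarrow> norm (\<nu> s) = 1"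
    and nuE: "\<And>s. s \<in> {0..1} \<Longrightarrow> \<nu> s \<bullet> E \<le> - \<kappa>"
    and ball: "\<And>s. s \<in> {0..1} \<Longrightarrow> ball (\<gamma> s + r *\<^sub>R \<nu> s) r \<subseteq> \<Omega>"
    using inner unfolding \<gamma>_def by metis
  have M: "M \<ge> 0"
  proof -
    have "\<gamma> 0 + r *\<^sub>R \<nu> 0 \<in> closure \<Omega>"
      using ball[of 0] r closure_subset[of \<Omega>] by (auto simp: subset_iff)
    then show ?thesis
      using bound by force
  qed
  define m where "m s = (\<nu> s \<bullet> U) / (- (\<nu> s \<bullet> E))" for s
  define V where "V = norm U + L"
  define c where "c = V\<^sup>2 / (2 * r * \<kappa>)"
  define W where "W = (1 + 1 / \<kappa>) * norm U"
  define T where "T s = U + m s *\<^sub>R E" for s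
  have L: "L \<ge> 0"
    using lip[of 0 1] by simp
  have V: "V \<ge> 0"
    using L by (simp add: V_def)
  have W: "W \<ge> 0"
    using \<kappa> by (simp add: W_def)
  have c: "c \<ge> 0"
    using r \<kappa> by (simp add: c_def)
  have m_bound: "\<bar>m s\<bar> \<le> norm U / \<kappa>" if "s \<in> {0..1}" for s
  proof -
    have "\<bar>\<nu> s \<bullet> U\<bar> \<le> norm U"
      using Cauchy_Schwarz_ineq2[of "\<nu> s" U] nu[OF that] by simp
    moreover have "\<kappa> \<le> \<bar>\<nu> s \<bullet> E\<bar>"
      using nuE[OF that] by simp
    ultimately show ?thesis
      unfolding m_def abs_divide abs_minus_cancel using \<kappa> by (intro frac_le) auto
  qed
  have diff: "norm (\<gamma> t - \<gamma> s) \<le> V * \<bar>t - s\<bar>" if "s \<in> {0..1}" "t \<in> {0..1}" for s t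
  proof -
    have "\<gamma> t - \<gamma> s = (t - s) *\<^sub>R U + (g t - g s) *\<^sub>R E"
      by (simp add: \<gamma>_def algebra_simps)
    also have "norm \<dots> \<le> \<bar>t - s\<bar> * norm U + \<bar>g t - g s\<bar>"
      using norm_triangle_ineq[of "(t - s) *\<^sub>R U" "(g t - g s) *\<^sub>R E"] E by simp
    also have "\<dots> \<le> V * \<bar>t - s\<bar>"
      using lip[OF that(2,1)] by (simp add: V_def algebra_simps)
    finally show ?thesis .
  qed
  have below: "m s * (t - s) - c * (t - s)\<^sup>2 \<le> g t - g s" if st: "s \<in> {0..1}" "t \<in> {0..1}" for s t
  proof -
    define k where "k = - (\<nu> s \<bullet> E)"
    have k: "k \<ge> \<kappa>"
      using nuE[OF st(1)] by (simp add: k_def)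
    define \<Delta> where "\<Delta> = \<gamma> t - \<gamma> s"
    have "\<gamma> t \<notin> ball (\<gamma> s + r *\<^sub>R \<nu> s) r"
      using outside[OF st(2)] ball[OF st(1)] by (auto simp: \<gamma>_def)
    then have "r \<le> norm (r *\<^sub>R \<nu> s - \<Delta>)"
      by (simp add: \<Delta>_def dist_norm algebra_simps)
    then have "r\<^sup>2 \<le> (norm (r *\<^sub>R \<nu> s - \<Delta>))\<^sup>2"
      using r by (intro power_mono) auto
    also have "\<dots> = r\<^sup>2 - 2 * r * (\<nu> s \<bullet> \<Delta>) + (norm \<Delta>)\<^sup>2"
    proof -
      have "\<nu> s \<bullet> \<nu> s = 1"
        using nu[OF st(1)] by (simp add: norm_eq_1)
      then show ?thesis
        unfolding power2_norm_eq_inner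
        by (simp add: inner_diff_left inner_diff_right inner_commute power2_eq_square algebra_simps)
    qed
    finally have "2 * r * (\<nu> s \<bullet> \<Delta>) \<le> (norm \<Delta>)\<^sup>2"
      by simp
    also have "\<dots> \<le> (V * \<bar>t - s\<bar>)\<^sup>2"
      using diff[OF st] by (intro power_mono) (auto simp: \<Delta>_def)
    also have "\<dots> = 2 * r * \<kappa> * (c * (t - s)\<^sup>2)"
      using r \<kappa> by (simp add: c_def power_mult_distrib)
    finally have "\<nu> s \<bullet> \<Delta> \<le> \<kappa> * (c * (t - s)\<^sup>2)"
      using r by (simp add: mult_ac)
    also have "\<dots> \<le> k * (c * (t - s)\<^sup>2)"
      using k c by (intro mult_right_mono) auto
    also have "\<nu> s \<bullet> \<Delta> = k * (m s * (t - s) - (g t - g s))"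
    proof -
      have eq: "\<Delta> = (t - s) *\<^sub>R U + (g t - g s) *\<^sub>R E"
        by (simp add: \<Delta>_def \<gamma>_def algebra_simps)
      have nuU: "\<nu> s \<bullet> U = k * m s"
        using k \<kappa> by (simp add: m_def k_def)
      have nuE': "\<nu> s \<bullet> E = - k"
        by (simp add: k_def)
      show ?thesis
        unfolding eq inner_add_right inner_scaleR_right nuU nuE' by (simp add: algebra_simps)
    qed
    finally have "k * (m s * (t - s) - (g t - g s)) \<le> k * (c * (t - s)\<^sup>2)" .
    then have "m s * (t - s) - (g t - g s) \<le> c * (t - s)\<^sup>2"
      using k \<kappa> by (simp only: mult_le_cancel_left_pos less_le_trans)
    then show ?thesis
      by simp
  qed
  have T_norm: "norm (T s) \<le> W" if "s \<in> {0..1}" for s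
    using norm_triangle_ineq[of U "m s *\<^sub>R E"] m_bound[OF that] E
    by (simp add: T_def W_def algebra_simps)
  have T_tangent: "T s \<bullet> \<nu> s = 0" if "s \<in> {0..1}" for s
    using nuE[OF that] \<kappa> by (simp add: T_def m_def inner_add_right inner_diff_right inner_commute)
  \<comment> \<open>Large enough to contain the curve and all auxiliary points of the parabolas.\<close>
  define S where "S = cball (\<gamma> 0) (V + 2 * r)"
  obtain \<Lambda> where \<Lambda>: "\<Lambda> \<ge> 0" "\<And>x y. x \<in> S \<Longrightarrow> y \<in> S \<Longrightarrow> \<bar>p x - p y\<bar> \<le> \<Lambda> * norm (x - y)"
    using poly_on_parabolas_locally_lipschitz[OF p, of S] by (auto simp: S_def)
  define A where "A = 12 * real (2 * n + 1) * M * (W / r)"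
  define b where "b = 3 * c + W\<^sup>2 / r"
  have step: "\<bar>p (\<gamma> t) - p (\<gamma> s)\<bar> \<le> A * h + \<Lambda> * (h * (m t - m s) + b * h\<^sup>2)"
    if st: "s \<in> {0..1}" "t \<in> {0..1}" and h: "t = s + h" "0 < h" "h * W \<le> r" for s t h
  proof -
    define e where "e = g t - g s - m s * h"
    have e: "\<bar>e\<bar> \<le> h * (m t - m s) + 3 * c * h\<^sup>2"
    proof -
      have "- (c * h\<^sup>2) \<le> e"
        using below[OF st] h by (simp add: e_def)
      moreover have "e \<le> h * (m t - m s) + c * h\<^sup>2"
        using below[OF st(2,1)] h by (simp add: e_def algebra_simps)
      moreover have "0 \<le> c * h\<^sup>2"
        using c by simp
      ultimately show ?thesis
        by linarith
    qed
    have hT: "norm (h *\<^sub>R T s) \<le> h * W"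
      using T_norm[OF st(1)] h by simp
    \<comment> \<open>The point of the parabola over the tangential step, from which \<open>\<gamma> t\<close> deviates by \<open>e\<close> vertically and \<open>O(h\<^sup>2)\<close> normally.\<close>
    define z where "z = \<gamma> s + h *\<^sub>R T s + ((norm (h *\<^sub>R T s))\<^sup>2 / r) *\<^sub>R \<nu> s"
    have hTr: "norm (h *\<^sub>R T s) \<le> r"
      using hT h(3) by (rule order_trans)
    have "cball (\<gamma> s + r *\<^sub>R \<nu> s) r \<subseteq> closure \<Omega>"
      using closure_mono[OF ball[OF st(1)]] r by simp
    then have "\<bar>p z - p (\<gamma> s)\<bar> \<le> 12 * real (2 * n + 1) * M * (norm (h *\<^sub>R T s) / r)"
      unfolding z_def
      by (intro tangential_increment[OF p bound _ r nu[OF st(1)] _ hTr]) (auto simp: T_tangent[OF st(1)])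
    also have "\<dots> \<le> 12 * real (2 * n + 1) * M * (h * W / r)"
      using hT M r by (intro mult_left_mono divide_right_mono) auto
    finally have 1: "\<bar>p z - p (\<gamma> s)\<bar> \<le> A * h"
      by (simp add: A_def mult_ac)
    have q: "(norm (h *\<^sub>R T s))\<^sup>2 / r \<le> (h * W)\<^sup>2 / r"
      using hT r by (intro divide_right_mono power_mono) auto
    have "\<gamma> t - z = e *\<^sub>R E - ((norm (h *\<^sub>R T s))\<^sup>2 / r) *\<^sub>R \<nu> s"
      unfolding z_def by (simp add: \<gamma>_def T_def e_def h(1) algebra_simps)
    then have "norm (\<gamma> t - z) \<le> \<bar>e\<bar> + (norm (h *\<^sub>R T s))\<^sup>2 / r"
      using norm_triangle_ineq4[of "e *\<^sub>R E" "((norm (h *\<^sub>R T s))\<^sup>2 / r) *\<^sub>R \<nu> s"] E nu[OF st(1)] r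
      by simp
    then have near: "norm (\<gamma> t - z) \<le> h * (m t - m s) + b * h\<^sup>2"
      using e q by (simp add: b_def power_mult_distrib algebra_simps)
    have "\<gamma> t \<in> S"
    proof -
      have "norm (\<gamma> t - \<gamma> 0) \<le> V * \<bar>t\<bar>"
        using diff[of 0 t] st by simp
      also have "\<dots> \<le> V * 1"
        using st V by (intro mult_left_mono) auto
      finally show ?thesis
        using r by (simp add: S_def dist_norm norm_minus_commute)
    qed
    moreover have "z \<in> S"
    proof -
      have "norm (\<gamma> s - \<gamma> 0) \<le> V * \<bar>s\<bar>"
        using diff[of 0 s] st by simp
      also have "\<dots> \<le> V * 1"
        using st V by (intro mult_left_mono) auto
      finally have "norm (\<gamma> s - \<gamma> 0) \<le> V"
        by simp
      moreover note hTr
      moreover have "norm (((norm (h *\<^sub>R T s))\<^sup>2 / r) *\<^sub>R \<nu> s) \<le> r"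
      proof -
        have "(norm (h *\<^sub>R T s))\<^sup>2 / r \<le> r\<^sup>2 / r"
          using hTr r by (intro divide_right_mono power_mono) auto
        then show ?thesis
          using r nu[OF st(1)] by (simp add: power2_eq_square)
      qed
      moreover have "z - \<gamma> 0 = (\<gamma> s - \<gamma> 0) + h *\<^sub>R T s + ((norm (h *\<^sub>R T s))\<^sup>2 / r) *\<^sub>R \<nu> s"
        by (simp add: z_def)
      ultimately have "norm (z - \<gamma> 0) \<le> V + r + r"
        by (metis (no_types, lifting) add_mono norm_triangle_le)
      then show ?thesis
        by (simp add: S_def dist_norm norm_minus_commute)
    qed
    ultimately have "\<bar>p (\<gamma> t) - p z\<bar> \<le> \<Lambda> * norm (\<gamma> t - z)"
      by (rule \<Lambda>(2))
    also have "\<dots> \<le> \<Lambda> * (h * (m t - m s) + b * h\<^sup>2)"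
      using near \<Lambda>(1) by (rule mult_left_mono)
    finally show ?thesis
      using 1 by linarith
  qed
  have main: "\<bar>p (\<gamma> 1) - p (\<gamma> 0)\<bar> \<le> A + \<Lambda> * (2 * (norm U / \<kappa>) + b) * inverse (real N)"
    if N: "N \<ge> 1" "W \<le> r * real N" for N
  proof -
    define h where "h = 1 / real N"
    define s where "s i = real i * h" for i
    have h: "h > 0" "h * W \<le> r" "real N * h = 1"
      using N by (simp_all add: h_def field_simps)
    have s: "s i \<in> {0..1}" if "i \<le> N" for i
      using that N by (simp add: s_def h_def)
    have s01: "s N = 1" "s 0 = 0"
      using h by (simp_all add: s_def)
    have "\<bar>p (\<gamma> 1) - p (\<gamma> 0)\<bar> = \<bar>\<Sum>i<N. p (\<gamma> (s (Suc i))) - p (\<gamma> (s i))\<bar>"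
      using sum_lessThan_telescope[of "\<lambda>i. p (\<gamma> (s i))" N] by (simp only: s01)
    also have "\<dots> \<le> (\<Sum>i<N. \<bar>p (\<gamma> (s (Suc i))) - p (\<gamma> (s i))\<bar>)"
      by (rule sum_abs)
    also have "\<dots> \<le> (\<Sum>i<N. A * h + \<Lambda> * (h * (m (s (Suc i)) - m (s i)) + b * h\<^sup>2))"
    proof (intro sum_mono step)
      fix i assume "i \<in> {..<N}"
      then show "s i \<in> {0..1}" "s (Suc i) \<in> {0..1}"
        by (auto intro!: s simp del: atLeastAtMost_iff)
      show "s (Suc i) = s i + h"
        by (simp add: s_def algebra_simps)
    qed (use h in auto)
    also have "\<dots> = real N * h * A + \<Lambda> * (h * (\<Sum>i<N. m (s (Suc i)) - m (s i)) + real N * h * b * h)"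
    proof -
      have "(\<Sum>i<N. A * h + \<Lambda> * (h * f i + b * h\<^sup>2)) = real N * h * A + \<Lambda> * (h * sum f {..<N} + real N * h * b * h)"
        for f
        by (simp add: sum.distrib sum_distrib_left[symmetric] power2_eq_square distrib_left)
      then show ?thesis .
    qed
    also have "\<dots> = A + \<Lambda> * (h * (m 1 - m 0) + b * h)"
      using sum_lessThan_telescope[of "\<lambda>i. m (s i)" N] h(3) by (simp only: s01) simp
    also have "\<dots> \<le> A + \<Lambda> * (h * (2 * (norm U / \<kappa>)) + b * h)"
    proof -
      have "m 1 - m 0 \<le> 2 * (norm U / \<kappa>)"
        using m_bound[of 0] m_bound[of 1] by simp
      then show ?thesis
        using \<Lambda>(1) h by (intro add_left_mono mult_left_mono add_right_mono) auto
    qed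
    also have "\<dots> = A + \<Lambda> * (2 * (norm U / \<kappa>) + b) * inverse (real N)"
      by (simp add: h_def algebra_simps inverse_eq_divide)
    finally show ?thesis .
  qed
  have "(\<lambda>N. A + \<Lambda> * (2 * (norm U / \<kappa>) + b) * inverse (real N)) \<longlonglongrightarrow> A + \<Lambda> * (2 * (norm U / \<kappa>) + b) * 0"
    by (intro tendsto_intros lim_inverse_n)
  moreover have "\<exists>N0. \<forall>N\<ge>N0. \<bar>p (\<gamma> 1) - p (\<gamma> 0)\<bar> \<le> A + \<Lambda> * (2 * (norm U / \<kappa>) + b) * inverse (real N)"
  proof (intro exI allI impI main)
    fix N assume N: "N \<ge> Suc (nat \<lceil>W / r\<rceil>)"
    then show "N \<ge> 1"
      by simp
    have "W / r \<le> real N"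
      using N by linarith
    then show "W \<le> r * real N"
      using r by (simp add: field_simps)
  qed
  ultimately have "\<bar>p (\<gamma> 1) - p (\<gamma> 0)\<bar> \<le> A + \<Lambda> * (2 * (norm U / \<kappa>) + b) * 0"
    by (rule LIMSEQ_le_const)
  then show ?thesis
    by (simp add: \<gamma>_def A_def W_def)
qed

section \<open>Lipschitz charts of the boundary\<close>

definition interior_ball_property :: "'a::euclidean_space set \<Rightarrow> real \<Rightarrow> bool" where
  "interior_ball_property \<Omega> r \<longleftrightarrow>
     (\<forall>y\<in>frontier \<Omega>. \<exists>\<nu>. norm \<nu> = 1 \<and> ball (y + r *\<^sub>R \<nu>) r \<subseteq> \<Omega>)"

text \<open>The factor \<open>2 n + 1\<close> is split off so that one set \<open>Y\<close> serves all degrees at once, with a quality that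
  degrades linearly in the degree.\<close>

definition polynomial_net :: "'a::euclidean_space set \<Rightarrow> 'a set \<Rightarrow> 'a set \<Rightarrow> real \<Rightarrow> bool" where
  "polynomial_net \<Omega> S Y \<epsilon> \<longleftrightarrow>
     (\<forall>n p M. poly_on_parabolas n p \<longrightarrow> (\<forall>z\<in>closure \<Omega>. \<bar>p z\<bar> \<le> M) \<longrightarrow>
        (\<forall>y\<in>S. \<exists>y'\<in>Y. \<bar>p y - p y'\<bar> \<le> \<epsilon> * real (2 * n + 1) * M))"

text \<open>The equation of sets in \<^const>\<open>lipschitz_domain\<close>, in pointwise form and without the inverse rotation.\<close>

definition graph_chart ::
    "(real ^ 'n) set \<Rightarrow> real ^ 'n \<Rightarrow> 'n \<Rightarrow> real \<Rightarrow> (real ^ 'n) set \<Rightarrow> (real ^ 'n \<Rightarrow> real) \<Rightarrow> real ^ 'n ^ 'n \<Rightarrow> bool" where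
  "graph_chart \<Omega> x k r B \<phi> R \<longleftrightarrow> \<phi> ` B \<subseteq> {-r<..<r} \<and>
     (\<forall>\<xi>\<in>B. \<forall>t\<in>{-r<..<r}. x + R *v cyl_point k \<xi> t \<in> \<Omega> \<longleftrightarrow> t < \<phi> \<xi>)"

lemma orthogonal_matrix_inv:
  fixes R :: "real ^ 'n ^ 'n"
  assumes "orthogonal_matrix R"
  shows "matrix_inv R *v (R *v z) = z" "R *v (matrix_inv R *v z) = z"
proof -
  have "\<exists>A'. R ** A' = mat 1 \<and> A' ** R = mat 1"
    using assms by (auto simp: orthogonal_matrix_def)
  then have "R ** matrix_inv R = mat 1 \<and> matrix_inv R ** R = mat 1"
    unfolding matrix_inv_def by (rule someI_ex)
  then show "matrix_inv R *v (R *v z) = z" "R *v (matrix_inv R *v z) = z"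
    by (simp_all add: matrix_vector_mul_assoc)
qed

lemma orthogonal_matrix_inner:
  fixes R :: "real ^ 'n ^ 'n"
  assumes "orthogonal_matrix R"
  shows "(R *v z) \<bullet> (R *v w) = z \<bullet> w" "norm (R *v z) = norm z"
proof -
  show inner: "(R *v z) \<bullet> (R *v w) = z \<bullet> w" for z w
  proof -
    have "(R *v z) \<bullet> (R *v w) = z \<bullet> (transpose R *v (R *v w))"
      by (metis dot_lmul_matrix vector_transpose_matrix transpose_transpose inner_commute)
    then show ?thesis
      using assms by (simp add: matrix_vector_mul_assoc orthogonal_matrix_def)
  qed
  show "norm (R *v z) = norm z"
    by (simp add: norm_eq_sqrt_inner inner)
qed

lemma cyl_point_inject:
  assumes "\<xi> \<in> base_hyperplane k" "\<xi>' \<in> base_hyperplane k"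
  shows "cyl_point k \<xi> t = cyl_point k \<xi>' t' \<longleftrightarrow> \<xi> = \<xi>' \<and> t = t'"
proof
  assume eq: "cyl_point k \<xi> t = cyl_point k \<xi>' t'"
  from arg_cong[OF eq, of "\<lambda>v. v $ k"] assms have "t = t'"
    by (simp add: cyl_point_def base_hyperplane_def axis_def)
  then show "\<xi> = \<xi>' \<and> t = t'"
    using eq by (simp add: cyl_point_def)
qed simp

lemma lipschitz_domain_charts:
  fixes \<Omega> :: "(real ^ 'n) set"
  assumes "lipschitz_domain \<Omega>"
  obtains k :: 'n and L r :: real and B where "0 < L" "0 < r"
    "openin (top_of_set (base_hyperplane k)) B" "0 \<in> B"
    "\<And>x. x \<in> frontier \<Omega> \<Longrightarrow> \<exists>\<phi> R. graph_chart \<Omega> x k r B \<phi> R \<and> orthogonal_matrix R \<and> L-lipschitz_on B \<phi>"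
proof -
  obtain k :: 'n and L r :: real and B where
    *: "0 < L" "0 < r" "openin (top_of_set (base_hyperplane k)) B" "0 \<in> B"
    and charts: "\<And>x. x \<in> frontier \<Omega> \<Longrightarrow> \<exists>(\<phi> :: real ^ 'n \<Rightarrow> real) (R :: real ^ 'n ^ 'n).
           \<phi> ` B \<subseteq> {-r<..<r} \<and> rotation_matrix R \<and> \<phi> 0 = 0 \<and> L-lipschitz_on B \<phi> \<and>
           (\<lambda>y. matrix_inv R *v (y - x)) `
              (\<Omega> \<inter> {x + R *v cyl_point k \<xi> t | \<xi> t. \<xi> \<in> B \<and> t \<in> {-r<..<r}})
            = {cyl_point k \<xi> t | \<xi> t. \<xi> \<in> B \<and> t \<in> {-r<..<\<phi> \<xi>}}"
    using assms unfolding lipschitz_domain_def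
    by - (elim conjE exE, rule that; (assumption | (drule (1) bspec, assumption)))
  have BH: "\<xi> \<in> base_hyperplane k" if "\<xi> \<in> B" for \<xi>
    using that openin_imp_subset[OF *(3)] by auto
  show ?thesis
  proof (rule that[OF *])
    fix x assume "x \<in> frontier \<Omega>"
    from charts[OF this] obtain \<phi> R where \<phi>: "\<phi> ` B \<subseteq> {-r<..<r}" "L-lipschitz_on B \<phi>" and R: "rotation_matrix R"
      and eq: "(\<lambda>y. matrix_inv R *v (y - x)) `
              (\<Omega> \<inter> {x + R *v cyl_point k \<xi> t | \<xi> t. \<xi> \<in> B \<and> t \<in> {-r<..<r}})
            = {cyl_point k \<xi> t | \<xi> t. \<xi> \<in> B \<and> t \<in> {-r<..<\<phi> \<xi>}}"
      by (elim conjE exE) (rule that; assumption)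
    have orth: "orthogonal_matrix R"
      using R by (simp add: rotation_matrix_def)
    have "x + R *v cyl_point k \<xi> t \<in> \<Omega> \<longleftrightarrow> t < \<phi> \<xi>" if \<xi>: "\<xi> \<in> B" and t: "t \<in> {-r<..<r}" for \<xi> t
    proof
      assume "x + R *v cyl_point k \<xi> t \<in> \<Omega>"
      then have "x + R *v cyl_point k \<xi> t
          \<in> \<Omega> \<inter> {x + R *v cyl_point k \<xi> t | \<xi> t. \<xi> \<in> B \<and> t \<in> {-r<..<r}}"
        using \<xi> t by blast
      from imageI[OF this, of "\<lambda>y. matrix_inv R *v (y - x)"]
      have "cyl_point k \<xi> t \<in> {cyl_point k \<xi> t | \<xi> t. \<xi> \<in> B \<and> t \<in> {-r<..<\<phi> \<xi>}}"
        unfolding eq by (simp only: add_diff_cancel_left' orthogonal_matrix_inv[OF orth])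
      then obtain \<xi>' t' where "cyl_point k \<xi> t = cyl_point k \<xi>' t'" "\<xi>' \<in> B" "t' \<in> {-r<..<\<phi> \<xi>'}"
        by blast
      then show "t < \<phi> \<xi>"
        using cyl_point_inject[OF BH[OF \<xi>] BH[of \<xi>']] by auto
    next
      assume "t < \<phi> \<xi>"
      then have "cyl_point k \<xi> t \<in> (\<lambda>y. matrix_inv R *v (y - x)) `
              (\<Omega> \<inter> {x + R *v cyl_point k \<xi> t | \<xi> t. \<xi> \<in> B \<and> t \<in> {-r<..<r}})"
        unfolding eq using \<xi> t by force
      then obtain y where "y \<in> \<Omega>" "cyl_point k \<xi> t = matrix_inv R *v (y - x)"
        by blast
      then show "x + R *v cyl_point k \<xi> t \<in> \<Omega>"
        by (simp add: orthogonal_matrix_inv[OF orth])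
    qed
    then show "\<exists>\<phi> R. graph_chart \<Omega> x k r B \<phi> R \<and> orthogonal_matrix R \<and> L-lipschitz_on B \<phi>"
      using \<phi> orth unfolding graph_chart_def by blast
  qed
qed

lemma cyl_point_decomposition: "w - (w $ k) *\<^sub>R axis k 1 \<in> base_hyperplane k"
    "cyl_point k (w - (w $ k) *\<^sub>R axis k 1) (w $ k) = w"
  by (simp_all add: base_hyperplane_def cyl_point_def axis_def)

text \<open>Graph points are outside \<open>\<Omega>\<close>, and are limits of the points vertically below them.\<close>

lemma graph_in_frontier:
  assumes chart: "graph_chart \<Omega> x k r B \<phi> R" and "\<xi> \<in> B" and "open \<Omega>"
  shows "x + R *v cyl_point k \<xi> (\<phi> \<xi>) \<in> frontier \<Omega>"
proof -
  define y where "y t = x + R *v cyl_point k \<xi> t" for t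
  have \<phi>: "\<phi> \<xi> \<in> {-r<..<r}"
    using chart \<open>\<xi> \<in> B\<close> by (auto simp: graph_chart_def)
  have y_iff: "y t \<in> \<Omega> \<longleftrightarrow> t < \<phi> \<xi>" if "t \<in> {-r<..<r}" for t
    using chart \<open>\<xi> \<in> B\<close> that by (simp add: graph_chart_def y_def)
  have "y = (\<lambda>t. x + R *v \<xi> + t *\<^sub>R (R *v axis k 1))"
    by (simp add: fun_eq_iff y_def cyl_point_def matrix_vector_right_distrib matrix_vector_mult_scaleR)
  then have "continuous_on UNIV y"
    by (auto intro!: continuous_intros)
  then have "(y \<longlongrightarrow> y (\<phi> \<xi>)) (at_left (\<phi> \<xi>))"
    by (simp add: continuous_on_eq_continuous_at isCont_def filterlim_at_split)
  moreover have "\<forall>\<^sub>F t in at_left (\<phi> \<xi>). y t \<in> closure \<Omega>"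
  proof (rule eventually_mono)
    show "\<forall>\<^sub>F t in at_left (\<phi> \<xi>). t \<in> {-r<..<\<phi> \<xi>}"
      using \<phi> by (intro eventually_at_left_real) auto
    show "y t \<in> closure \<Omega>" if "t \<in> {-r<..<\<phi> \<xi>}" for t
      using that \<phi> y_iff[of t] closure_subset[of \<Omega>] by auto
  qed
  ultimately have "y (\<phi> \<xi>) \<in> closure \<Omega>"
    by (intro Lim_in_closed_set[of "closure \<Omega>" y]) auto
  then show ?thesis
    using y_iff[OF \<phi>] \<open>open \<Omega>\<close> by (simp add: frontier_def interior_open y_def)
qed

text \<open>A boundary point cannot lie strictly above the graph: as \<open>\<phi>\<close> is continuous, a whole
  neighbourhood of it would lie above the graph and miss \<open>\<Omega>\<close>.\<close>

lemma frontier_in_graph: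
  fixes \<Omega> :: "(real ^ 'n) set"
  assumes chart: "graph_chart \<Omega> x k r B \<phi> R" and R: "orthogonal_matrix R"
    and lip: "L-lipschitz_on B \<phi>" and B: "\<And>\<xi>. \<xi> \<in> base_hyperplane k \<Longrightarrow> (\<And>i. \<bar>\<xi> $ i\<bar> \<le> b) \<Longrightarrow> \<xi> \<in> B"
    and "b \<le> r" and "open \<Omega>" and y: "y \<in> frontier \<Omega>" "dist x y < b"
  obtains \<xi> where "\<xi> \<in> base_hyperplane k" "\<And>i. \<bar>\<xi> $ i\<bar> \<le> b" "y = x + R *v cyl_point k \<xi> (\<phi> \<xi>)"
proof -
  define w where "w z = matrix_inv R *v (z - x)" for z
  define H where "H z = w z - (w z $ k) *\<^sub>R axis k 1" for z
  have z_eq: "z = x + R *v cyl_point k (H z) (w z $ k)" for z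
    by (simp add: H_def cyl_point_decomposition w_def orthogonal_matrix_inv[OF R])
  have w_diff: "norm (w z - w z') = dist z z'" for z z'
  proof -
    have "w z - w z' = matrix_inv R *v (z - z')"
      by (simp add: w_def flip: matrix_vector_mult_diff_distrib)
    then have "norm (w z - w z') = norm (R *v (matrix_inv R *v (z - z')))"
      by (simp add: orthogonal_matrix_inner[OF R])
    then show ?thesis
      by (simp add: orthogonal_matrix_inv[OF R] dist_norm)
  qed
  have w_x: "w x = 0"
    by (simp add: w_def)
  have w_le: "\<bar>w z $ i\<bar> < b" if "dist x z < b" for z i
    using component_le_norm_cart[of "w z" i] w_diff[of z x] w_x that by (simp add: dist_commute)
  have b: "b > 0"
    using y(2) by (meson le_less_trans zero_le_dist)
  have H_B: "H z \<in> B" "\<And>i. \<bar>H z $ i\<bar> \<le> b" "w z $ k \<in> {-r<..<r}" "H z \<in> base_hyperplane k" if "dist x z < b" for z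
  proof -
    show H: "H z \<in> base_hyperplane k"
      by (simp add: H_def cyl_point_decomposition)
    show Hb: "\<bar>H z $ i\<bar> \<le> b" for i
      using w_le[OF that, of i] b by (cases "i = k") (simp_all add: H_def axis_def)
    show "H z \<in> B"
      using H Hb by (rule B)
    show "w z $ k \<in> {-r<..<r}"
      using w_le[OF that, of k] \<open>b \<le> r\<close> by auto
  qed
  have in_iff: "z \<in> \<Omega> \<longleftrightarrow> w z $ k < \<phi> (H z)" if "dist x z < b" for z
  proof -
    have "x + R *v cyl_point k (H z) (w z $ k) \<in> \<Omega> \<longleftrightarrow> w z $ k < \<phi> (H z)"
      using chart H_B[OF that] unfolding graph_chart_def by blast
    then show ?thesis
      by (simp only: z_eq[symmetric])
  qed
  have "y \<notin> \<Omega>"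
    using y(1) \<open>open \<Omega>\<close> by (simp add: frontier_def interior_open)
  then have ge: "\<phi> (H y) \<le> w y $ k"
    using in_iff[OF y(2)] by simp
  have "\<not> \<phi> (H y) < w y $ k"
  proof
    assume less: "\<phi> (H y) < w y $ k"
    \<comment> \<open>So close to \<open>y\<close> the chart applies, and moving from \<open>y\<close> changes \<open>t - \<phi> \<xi>\<close> by at most \<open>2 L + 1\<close> times the distance moved.\<close>
    define \<epsilon> where "\<epsilon> = min (b - dist x y) ((w y $ k - \<phi> (H y)) / (2 * L + 1))"
    have L: "L \<ge> 0"
      using lip by (rule lipschitz_on_nonneg)
    then have "\<epsilon> > 0"
      using y(2) less by (simp add: \<epsilon>_def)
    moreover have "y \<in> closure \<Omega>"
      using y(1) by (simp add: frontier_def)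
    ultimately obtain z where z: "z \<in> \<Omega>" "dist z y < \<epsilon>"
      unfolding closure_approachable by blast
    have dz: "dist x z < b"
      using dist_triangle[of x z y] z(2) by (simp add: \<epsilon>_def dist_commute)
    define \<delta> where "\<delta> = dist z y"
    have k1: "\<bar>w z $ k - w y $ k\<bar> \<le> \<delta>"
      using component_le_norm_cart[of "w z - w y" k] w_diff[of z y] by (simp add: \<delta>_def)
    have "norm (H z - H y) \<le> norm (w z - w y) + norm ((w z $ k - w y $ k) *\<^sub>R axis k (1::real))"
    proof -
      have "H z - H y = (w z - w y) - (w z $ k - w y $ k) *\<^sub>R axis k 1"
        by (simp add: H_def algebra_simps)
      then show ?thesis
        by (simp only: norm_triangle_ineq4)
    qed
    also have "\<dots> \<le> 2 * \<delta>"
      using k1 w_diff[of z y] by (simp add: \<delta>_def norm_axis_1)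
    finally have "L * norm (H z - H y) \<le> L * (2 * \<delta>)"
      using L by (rule mult_left_mono)
    then have "\<bar>\<phi> (H z) - \<phi> (H y)\<bar> \<le> L * (2 * \<delta>)"
      using lipschitz_onD[OF lip H_B(1)[OF dz] H_B(1)[OF y(2)]] by (simp add: dist_norm)
    moreover have "(2 * L + 1) * \<delta> < w y $ k - \<phi> (H y)"
      using z(2) L by (simp add: \<epsilon>_def \<delta>_def field_simps)
    ultimately have "\<phi> (H z) < w z $ k"
      using k1 by (simp add: algebra_simps abs_le_iff)
    then show False
      using in_iff[OF dz] z(1) by simp
  qed
  then have "\<phi> (H y) = w y $ k"
    using ge by simp
  then have "y = x + R *v cyl_point k (H y) (\<phi> (H y))"
    using z_eq[of y] by simp
  then show ?thesis
    using that[of "H y"] H_B[OF y(2)] by blast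
qed

text \<open>The points above a Lipschitz graph contain a vertical cone with apex \<open>y\<close>, which an interior ball
  touching at \<open>y\<close> must avoid. So its inward normal makes a nonpositive inner product with every direction of the cone. Testing
  with the horizontal part of the normal plus \<open>L\<close> times the vertical yields \<open>1 - c\<^sup>2 + L c \<le> 0\<close> for the vertical component
  \<open>c\<close> of the normal, which forces \<open>c\<close> to be negative and bounded away from \<open>0\<close>.\<close>

lemma normal_transversal:
  fixes \<Omega> :: "(real ^ 'n) set"
  assumes chart: "graph_chart \<Omega> x k r B \<phi> R" and R: "orthogonal_matrix R"
    and lip: "L-lipschitz_on B \<phi>" and "0 < L"
    and B: "openin (top_of_set (base_hyperplane k)) B" and \<xi>: "\<xi> \<in> B"
    and y: "y = x + R *v cyl_point k \<xi> (\<phi> \<xi>)"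
    and \<nu>: "norm \<nu> = 1" "ball (y + \<rho> *\<^sub>R \<nu>) \<rho> \<subseteq> \<Omega>" and "0 < \<rho>"
  shows "\<nu> \<bullet> (R *v axis k 1) \<le> - (1 / (1 + L))"
proof -
  define \<omega> where "\<omega> = matrix_inv R *v \<nu>"
  have \<nu>_eq: "\<nu> = R *v \<omega>"
    by (simp add: \<omega>_def orthogonal_matrix_inv[OF R])
  have n\<omega>: "norm \<omega> = 1"
    using \<nu>(1) by (simp add: \<nu>_eq orthogonal_matrix_inner[OF R])
  define c where "c = \<omega> $ k"
  define h where "h = \<omega> - c *\<^sub>R axis k 1"
  have c: "\<nu> \<bullet> (R *v axis k 1) = c"
    by (simp add: \<nu>_eq orthogonal_matrix_inner[OF R] inner_axis c_def)
  have h: "h \<in> base_hyperplane k"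
    unfolding h_def c_def by (rule cyl_point_decomposition)
  have c1: "\<bar>c\<bar> \<le> 1"
    using component_le_norm_cart[of \<omega> k] n\<omega> by (simp add: c_def)
  have h_inner: "h \<bullet> \<omega> = 1 - c\<^sup>2"
    using n\<omega> by (simp add: h_def inner_diff_left inner_axis' c_def norm_eq_1 power2_eq_square)
  have h1: "norm h \<le> 1"
  proof -
    have "h \<bullet> h = 1 - c\<^sup>2"
      using h_inner h by (simp add: h_def base_hyperplane_def inner_diff_right inner_axis)
    then show ?thesis
      by (simp add: norm_le_square[of h 1])
  qed
  \<comment> \<open>As \<open>\<bar>h\<bar> \<le> 1\<close>, this direction does not enter the region below the graph.\<close>
  define v where "v = h + L *\<^sub>R axis k 1"
  have "v \<bullet> \<omega> = 1 - c\<^sup>2 + L * c"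
    by (simp add: v_def inner_add_left h_inner inner_axis' c_def)
  have \<phi>: "\<phi> \<xi> \<in> {-r<..<r}"
    using chart \<xi> by (auto simp: graph_chart_def)
  have outside: "\<forall>\<^sub>F e in at_right 0. y + e *\<^sub>R (R *v v) \<notin> \<Omega>"
  proof -
    obtain \<delta> where \<delta>: "\<delta> > 0" "\<And>\<zeta>. \<zeta> \<in> base_hyperplane k \<Longrightarrow> dist \<zeta> \<xi> < \<delta> \<Longrightarrow> \<zeta> \<in> B"
      using B \<xi> unfolding openin_euclidean_subtopology_iff by blast
    have "\<forall>\<^sub>F e in at_right 0. e \<in> {0<..<min \<delta> ((r - \<phi> \<xi>) / L)}"
      using \<delta>(1) \<phi> \<open>0 < L\<close> by (intro eventually_at_right_real) simp
    then show ?thesis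
    proof eventually_elim
      case (elim e)
      then have e: "0 < e" "e < \<delta>" "e * L < r - \<phi> \<xi>"
        using \<open>0 < L\<close> by (auto simp: field_simps)
      have "\<xi> \<in> base_hyperplane k"
        using openin_imp_subset[OF B] \<xi> by blast
      then have "\<xi> + e *\<^sub>R h \<in> base_hyperplane k"
        using h by (simp add: base_hyperplane_def)
      moreover have eh: "norm (e *\<^sub>R h) \<le> e"
        using e h1 mult_left_le[of "norm h" e] by simp
      moreover have "dist (\<xi> + e *\<^sub>R h) \<xi> = norm (e *\<^sub>R h)"
        by (simp only: dist_norm add_diff_cancel_left')
      ultimately have inB: "\<xi> + e *\<^sub>R h \<in> B"
        using e by (intro \<delta>(2)) linarith+
      have "\<bar>\<phi> (\<xi> + e *\<^sub>R h) - \<phi> \<xi>\<bar> \<le> L * norm (e *\<^sub>R h)"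
        using lipschitz_onD[OF lip inB \<xi>] by (simp add: dist_norm)
      also have "\<dots> \<le> L * e"
        using eh \<open>0 < L\<close> by (intro mult_left_mono) auto
      finally have "\<not> \<phi> \<xi> + e * L < \<phi> (\<xi> + e *\<^sub>R h)"
        by (simp add: mult.commute)
      moreover have "\<phi> \<xi> + e * L \<in> {-r<..<r}"
        using e \<phi> mult_pos_pos[OF e(1) \<open>0 < L\<close>] by auto
      ultimately have "x + R *v cyl_point k (\<xi> + e *\<^sub>R h) (\<phi> \<xi> + e * L) \<notin> \<Omega>"
        using chart inB by (simp add: graph_chart_def)
      moreover have "x + R *v cyl_point k (\<xi> + e *\<^sub>R h) (\<phi> \<xi> + e * L) = y + e *\<^sub>R (R *v v)"
        by (simp add: y cyl_point_def v_def matrix_vector_right_distrib algebra_simps flip: matrix_vector_mult_scaleR)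
      ultimately show ?case
        by simp
    qed
  qed
  have "\<forall>\<^sub>F e in at_right 0. v \<bullet> \<omega> \<le> e * ((norm v)\<^sup>2 / (2 * \<rho>))"
    using outside eventually_at_right_less[of 0]
  proof eventually_elim
    case (elim e)
    then have "y + e *\<^sub>R (R *v v) \<notin> ball (y + \<rho> *\<^sub>R \<nu>) \<rho>"
      using \<nu>(2) by blast
    then have "\<rho> \<le> norm (R *v (\<rho> *\<^sub>R \<omega> - e *\<^sub>R v))"
      by (simp add: dist_norm \<nu>_eq matrix_vector_mult_diff_distrib matrix_vector_mult_scaleR)
    then have "\<rho>\<^sup>2 \<le> (norm (\<rho> *\<^sub>R \<omega> - e *\<^sub>R v))\<^sup>2"
      using \<open>0 < \<rho>\<close> by (intro power_mono) (auto simp: orthogonal_matrix_inner[OF R])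
    also have "\<dots> = \<rho>\<^sup>2 - 2 * \<rho> * e * (v \<bullet> \<omega>) + e\<^sup>2 * (norm v)\<^sup>2"
    proof -
      have "\<omega> \<bullet> \<omega> = 1"
        using n\<omega> by (simp add: norm_eq_1)
      then show ?thesis
        unfolding power2_norm_eq_inner
        by (simp add: inner_diff_left inner_diff_right inner_commute power2_eq_square algebra_simps)
    qed
    finally have "e * (2 * \<rho> * (v \<bullet> \<omega>)) \<le> e * (e * (norm v)\<^sup>2)"
      by (simp add: power2_eq_square mult_ac)
    then have "2 * \<rho> * (v \<bullet> \<omega>) \<le> e * (norm v)\<^sup>2"
      using elim(2) by simp
    then show ?case
      using \<open>0 < \<rho>\<close> by (simp add: field_simps)
  qed
  moreover have "((\<lambda>e. e * ((norm v)\<^sup>2 / (2 * \<rho>))) \<longlongrightarrow> 0 * ((norm v)\<^sup>2 / (2 * \<rho>))) (at_right 0)"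
    by (intro tendsto_intros)
  ultimately have "v \<bullet> \<omega> \<le> 0 * ((norm v)\<^sup>2 / (2 * \<rho>))"
    by (intro tendsto_lowerbound) auto
  then have key: "1 - c\<^sup>2 + L * c \<le> 0"
    using \<open>v \<bullet> \<omega> = 1 - c\<^sup>2 + L * c\<close> by simp
  have "c < 0"
  proof (rule ccontr)
    assume "\<not> c < 0"
    then have "L * c \<ge> 0" "c \<ge> 0"
      using \<open>0 < L\<close> by simp_all
    moreover have "c\<^sup>2 \<le> 1"
      using c1 by (simp add: abs_square_le_1)
    ultimately have "c\<^sup>2 = 1" "L * c = 0"
      using key by linarith+
    then show False
      using \<open>0 < L\<close> by simp
  qed
  moreover have "c\<^sup>2 \<le> - c"
    using \<open>c < 0\<close> c1 mult_left_mono_neg[of "- 1" c c] by (simp add: power2_eq_square)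
  ultimately have "1 \<le> - c * (1 + L)"
    using key by (simp add: algebra_simps)
  then have "1 / (1 + L) \<le> - c"
    using \<open>0 < L\<close> by (simp add: field_simps)
  then show ?thesis
    unfolding c by simp
qed

section \<open>Finite nets on the boundary\<close>

lemma hyperplane_grid:
  fixes k :: "'n::finite"
  assumes "0 < a" "1 \<le> N"
  obtains G :: "(real ^ 'n) set" where "finite G" "card G \<le> (2 * N + 1) ^ (CARD('n) - 1)"
    "\<And>\<xi>. \<xi> \<in> G \<Longrightarrow> \<xi> \<in> base_hyperplane k \<and> (\<forall>i. \<bar>\<xi> $ i\<bar> \<le> a)"
    "\<And>\<xi>. \<xi> \<in> base_hyperplane k \<Longrightarrow> (\<And>i. \<bar>\<xi> $ i\<bar> \<le> a) \<Longrightarrow>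
      \<exists>\<xi>'\<in>G. norm (\<xi> - \<xi>') \<le> real CARD('n) * a / real N"
proof -
  define v :: "('n \<Rightarrow> int) \<Rightarrow> real ^ 'n"
    where "v f = (\<chi> i. if i = k then 0 else a * real_of_int (f i) / real N)" for f
  define I where "I = (UNIV - {k}) \<rightarrow>\<^sub>E {- int N..int N}"
  have N: "real N > 0"
    using assms by simp
  show ?thesis
  proof (rule that[of "v ` I"])
    show "finite (v ` I)"
      unfolding I_def by (intro finite_imageI finite_PiE) auto
    have "card (v ` I) \<le> card I"
      unfolding I_def by (intro card_image_le finite_PiE) auto
    also have "card I = (2 * N + 1) ^ (CARD('n) - 1)"
    proof -
      have "nat (2 * int N) = 2 * N"
        by simp
      then show ?thesis
        unfolding I_def by (simp add: card_PiE nat_add_distrib card_Diff_singleton)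
    qed
    finally show "card (v ` I) \<le> (2 * N + 1) ^ (CARD('n) - 1)" .
    show "\<xi> \<in> base_hyperplane k \<and> (\<forall>i. \<bar>\<xi> $ i\<bar> \<le> a)" if "\<xi> \<in> v ` I" for \<xi>
    proof (intro conjI allI)
      obtain f where f: "f \<in> I" "\<xi> = v f"
        using \<open>\<xi> \<in> v ` I\<close> by blast
      show "\<xi> \<in> base_hyperplane k"
        by (simp add: f v_def base_hyperplane_def)
      fix i
      show "\<bar>\<xi> $ i\<bar> \<le> a"
      proof (cases "i = k")
        case False
        then have "f i \<in> {- int N..int N}"
          using f(1) unfolding I_def by (intro PiE_mem[of f "UNIV - {k}"]) auto
        then have "\<bar>real_of_int (f i)\<bar> \<le> real N"
          by auto
        then have "a * \<bar>real_of_int (f i)\<bar> \<le> a * real N"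
          using assms by (intro mult_left_mono) auto
        then show ?thesis
          using False N assms by (simp add: f v_def abs_mult divide_simps)
      qed (use assms in \<open>simp add: f v_def\<close>)
    qed
    fix \<xi> :: "real ^ 'n"
    assume \<xi>: "\<xi> \<in> base_hyperplane k" "\<And>i. \<bar>\<xi> $ i\<bar> \<le> a"
    define f where "f = restrict (\<lambda>i. \<lfloor>\<xi> $ i * real N / a\<rfloor>) (UNIV - {k})"
    have "f \<in> I"
      unfolding I_def f_def
    proof (rule restrict_PiE_iff[THEN iffD2], rule ballI)
      fix i
      have "\<bar>\<xi> $ i\<bar> * real N \<le> a * real N"
        using \<xi>(2)[of i] by (intro mult_right_mono) auto
      then have "\<bar>\<xi> $ i * real N / a\<bar> \<le> real N"
        using assms by (simp add: abs_mult divide_simps)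
      then show "\<lfloor>\<xi> $ i * real N / a\<rfloor> \<in> {- int N..int N}"
        unfolding atLeastAtMost_iff by (intro conjI; linarith)
    qed
    moreover have "norm (\<xi> - v f) \<le> real CARD('n) * a / real N"
    proof -
      have "\<bar>(\<xi> - v f) $ i\<bar> \<le> a / real N" for i
      proof (cases "i = k")
        case True
        then show ?thesis
          using \<xi>(1) assms by (simp add: v_def base_hyperplane_def)
      next
        case False
        define z where "z = \<xi> $ i * real N / a"
        have "(\<xi> - v f) $ i = (a / real N) * (z - of_int \<lfloor>z\<rfloor>)"
          using False N assms by (simp add: v_def f_def z_def field_simps)
        moreover have "\<bar>z - of_int \<lfloor>z\<rfloor>\<bar> \<le> 1"
          by linarith
        then have "a / real N * \<bar>z - of_int \<lfloor>z\<rfloor>\<bar> \<le> a / real N * 1"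
          using assms by (intro mult_left_mono) auto
        ultimately show ?thesis
          using assms by (simp add: abs_mult)
      qed
      then have "(\<Sum>i\<in>UNIV. \<bar>(\<xi> - v f) $ i\<bar>) \<le> (\<Sum>i\<in>(UNIV :: 'n set). a / real N)"
        by (intro sum_mono)
      then show ?thesis
        using norm_le_l1_cart[of "\<xi> - v f"] by simp
    qed
    ultimately show "\<exists>\<xi>'\<in>v ` I. norm (\<xi> - \<xi>') \<le> real CARD('n) * a / real N"
      by blast
  qed
qed

text \<open>Over a cube contained in the base of the chart any two parameters are joined by a segment, and
  \<open>boundary_path_increment\<close> applies to the graph over it; so the graph over a grid in the cube is a net.\<close>

lemma boundary_patch_net:
  fixes \<Omega> :: "(real ^ 'n) set"
  assumes "open \<Omega>" "0 < \<rho>" "interior_ball_property \<Omega> \<rho>"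
    and chart: "graph_chart \<Omega> x k r B \<phi> R" and R: "orthogonal_matrix R"
    and lip: "L-lipschitz_on B \<phi>" and "0 < L"
    and B: "openin (top_of_set (base_hyperplane k)) B"
    and cube: "\<And>\<xi>. \<xi> \<in> base_hyperplane k \<Longrightarrow> (\<And>i. \<bar>\<xi> $ i\<bar> \<le> a) \<Longrightarrow> \<xi> \<in> B"
    and "0 < a" "a \<le> r" "1 \<le> N"
  obtains Y where "Y \<subseteq> frontier \<Omega>" "finite Y" "card Y \<le> (2 * N + 1) ^ (CARD('n) - 1)"
    "polynomial_net \<Omega> (frontier \<Omega> \<inter> ball x a) Y (12 * (2 + L) * real CARD('n) * a / \<rho> / real N)"
proof -
  obtain G :: "(real ^ 'n) set" where G: "finite G" "card G \<le> (2 * N + 1) ^ (CARD('n) - 1)"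
    and G_cube: "\<And>\<xi>. \<xi> \<in> G \<Longrightarrow> \<xi> \<in> base_hyperplane k \<and> (\<forall>i. \<bar>\<xi> $ i\<bar> \<le> a)"
    and G_net: "\<And>\<xi>. \<xi> \<in> base_hyperplane k \<Longrightarrow> (\<And>i. \<bar>\<xi> $ i\<bar> \<le> a) \<Longrightarrow>
      \<exists>\<xi>'\<in>G. norm (\<xi> - \<xi>') \<le> real CARD('n) * a / real N"
    using hyperplane_grid[OF \<open>0 < a\<close> \<open>1 \<le> N\<close>, of k] by metis
  define h where "h \<xi> = x + R *v cyl_point k \<xi> (\<phi> \<xi>)" for \<xi>
  have h_frontier: "h \<xi> \<in> frontier \<Omega>" if "\<xi> \<in> B" for \<xi>
    unfolding h_def using chart that \<open>open \<Omega>\<close> by (rule graph_in_frontier)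
  define E where "E = R *v axis k 1"
  have E: "norm E = 1"
    by (simp add: E_def orthogonal_matrix_inner[OF R] norm_axis_1)
  have h_eq: "h \<xi> = x + R *v \<xi> + \<phi> \<xi> *\<^sub>R E" for \<xi>
    by (simp add: h_def E_def cyl_point_def matrix_vector_right_distrib matrix_vector_mult_scaleR)
  have inner: "\<exists>\<nu>. norm \<nu> = 1 \<and> \<nu> \<bullet> E \<le> - (1 / (1 + L)) \<and> ball (h \<xi> + \<rho> *\<^sub>R \<nu>) \<rho> \<subseteq> \<Omega>" if \<xi>: "\<xi> \<in> B" for \<xi>
  proof -
    obtain \<nu> where \<nu>: "norm \<nu> = 1" "ball (h \<xi> + \<rho> *\<^sub>R \<nu>) \<rho> \<subseteq> \<Omega>"
      using assms(3) h_frontier[OF \<xi>] unfolding interior_ball_property_def by blast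
    have "\<nu> \<bullet> E \<le> - (1 / (1 + L))"
      unfolding E_def
      by (rule normal_transversal[OF chart R lip \<open>0 < L\<close> B \<xi> h_def \<nu> \<open>0 < \<rho>\<close>])
    then show ?thesis
      using \<nu> by blast
  qed
  have increment: "\<bar>p (h \<xi>') - p (h \<xi>)\<bar> \<le> 12 * real (2 * n + 1) * M * ((2 + L) * norm (\<xi>' - \<xi>) / \<rho>)"
    if p: "poly_on_parabolas n p" "\<And>z. z \<in> closure \<Omega> \<Longrightarrow> \<bar>p z\<bar> \<le> M"
      and \<xi>: "\<xi> \<in> base_hyperplane k" "\<And>i. \<bar>\<xi> $ i\<bar> \<le> a"
      and \<xi>': "\<xi>' \<in> base_hyperplane k" "\<And>i. \<bar>\<xi>' $ i\<bar> \<le> a" for n p M \<xi> \<xi>'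
  proof -
    define \<zeta> where "\<zeta> s = \<xi> + s *\<^sub>R (\<xi>' - \<xi>)" for s
    have \<zeta>B: "\<zeta> s \<in> B" if s: "s \<in> {0..1}" for s
    proof (rule cube)
      show "\<zeta> s \<in> base_hyperplane k"
        using \<xi>(1) \<xi>'(1) by (simp add: \<zeta>_def base_hyperplane_def)
      fix i
      have "\<zeta> s $ i = (1 - s) * \<xi> $ i + s * \<xi>' $ i"
        by (simp add: \<zeta>_def algebra_simps)
      also have "\<bar>\<dots>\<bar> \<le> (1 - s) * \<bar>\<xi> $ i\<bar> + s * \<bar>\<xi>' $ i\<bar>"
        using s abs_triangle_ineq[of "(1 - s) * \<xi> $ i" "s * \<xi>' $ i"] by (simp add: abs_mult)
      also have "\<dots> \<le> (1 - s) * a + s * a"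
        using s \<xi>(2) \<xi>'(2) by (intro add_mono mult_left_mono) auto
      finally show "\<bar>\<zeta> s $ i\<bar> \<le> a"
        by (simp add: algebra_simps)
    qed
    have path: "(x + R *v \<xi>) + s *\<^sub>R (R *v (\<xi>' - \<xi>)) + \<phi> (\<zeta> s) *\<^sub>R E = h (\<zeta> s)" for s
      by (simp add: h_eq \<zeta>_def matrix_vector_right_distrib matrix_vector_mult_scaleR)
    have "\<bar>p ((x + R *v \<xi>) + R *v (\<xi>' - \<xi>) + \<phi> (\<zeta> 1) *\<^sub>R E) - p ((x + R *v \<xi>) + \<phi> (\<zeta> 0) *\<^sub>R E)\<bar>
      \<le> 12 * real (2 * n + 1) * M * ((1 + 1 / (1 / (1 + L))) * norm (R *v (\<xi>' - \<xi>)) / \<rho>)"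
    proof (rule boundary_path_increment[OF p \<open>0 < \<rho>\<close> _ E, where L = "L * norm (\<xi>' - \<xi>)"])
      show "0 < 1 / (1 + L)"
        using \<open>0 < L\<close> by simp
      fix s :: real assume s: "s \<in> {0..1}"
      show "(x + R *v \<xi>) + s *\<^sub>R (R *v (\<xi>' - \<xi>)) + \<phi> (\<zeta> s) *\<^sub>R E \<notin> \<Omega>"
        using h_frontier[OF \<zeta>B[OF s]] \<open>open \<Omega>\<close> unfolding path by (simp add: frontier_def interior_open)
      show "\<exists>\<nu>. norm \<nu> = 1 \<and> \<nu> \<bullet> E \<le> - (1 / (1 + L)) \<and>
          ball ((x + R *v \<xi>) + s *\<^sub>R (R *v (\<xi>' - \<xi>)) + \<phi> (\<zeta> s) *\<^sub>R E + \<rho> *\<^sub>R \<nu>) \<rho> \<subseteq> \<Omega>"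
        unfolding path by (rule inner[OF \<zeta>B[OF s]])
      fix t :: real assume t: "t \<in> {0..1}"
      have "\<zeta> s - \<zeta> t = (s - t) *\<^sub>R (\<xi>' - \<xi>)"
        by (simp add: \<zeta>_def algebra_simps)
      then have "dist (\<zeta> s) (\<zeta> t) = norm (\<xi>' - \<xi>) * \<bar>s - t\<bar>"
        by (simp add: dist_norm)
      then show "\<bar>\<phi> (\<zeta> s) - \<phi> (\<zeta> t)\<bar> \<le> L * norm (\<xi>' - \<xi>) * \<bar>s - t\<bar>"
        using lipschitz_onD[OF lip \<zeta>B[OF s] \<zeta>B[OF t]] by (simp add: dist_norm mult.assoc)
    qed
    moreover have "(x + R *v \<xi>) + R *v (\<xi>' - \<xi>) + \<phi> (\<zeta> 1) *\<^sub>R E = h \<xi>'"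
      using path[of 1] by (simp add: \<zeta>_def)
    moreover have "(x + R *v \<xi>) + \<phi> (\<zeta> 0) *\<^sub>R E = h \<xi>"
      using path[of 0] by (simp add: \<zeta>_def)
    ultimately show ?thesis
      by (simp add: orthogonal_matrix_inner[OF R])
  qed
  show ?thesis
  proof (rule that[of "h ` G"])
    show "h ` G \<subseteq> frontier \<Omega>"
      using G_cube cube h_frontier by blast
    show "finite (h ` G)"
      using G(1) by simp
    show "card (h ` G) \<le> (2 * N + 1) ^ (CARD('n) - 1)"
      using card_image_le[OF G(1), of h] G(2) by simp
    show "polynomial_net \<Omega> (frontier \<Omega> \<inter> ball x a) (h ` G) (12 * (2 + L) * real CARD('n) * a / \<rho> / real N)"
      unfolding polynomial_net_def
    proof (intro allI impI ballI)
      fix n p M y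
      assume p: "poly_on_parabolas n p" "\<forall>z\<in>closure \<Omega>. \<bar>p z\<bar> \<le> M" and y: "y \<in> frontier \<Omega> \<inter> ball x a"
      have M: "M \<ge> 0"
        using p(2) y by (force simp: frontier_def)
      obtain \<xi> where \<xi>: "\<xi> \<in> base_hyperplane k" "\<And>i. \<bar>\<xi> $ i\<bar> \<le> a" and y_eq: "y = h \<xi>"
        using frontier_in_graph[OF chart R lip cube \<open>a \<le> r\<close> \<open>open \<Omega>\<close>, of y] y unfolding h_def by auto
      obtain \<xi>' where \<xi>': "\<xi>' \<in> G" "norm (\<xi> - \<xi>') \<le> real CARD('n) * a / real N"
        using G_net[OF \<xi>] by blast
      have "\<bar>p (h \<xi>) - p (h \<xi>')\<bar> \<le> 12 * real (2 * n + 1) * M * ((2 + L) * norm (\<xi> - \<xi>') / \<rho>)"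
        using G_cube[OF \<xi>'(1)] p \<xi> by (intro increment) auto
      also have "\<dots> \<le> 12 * real (2 * n + 1) * M * ((2 + L) * (real CARD('n) * a / real N) / \<rho>)"
        using \<xi>'(2) M \<open>0 < L\<close> \<open>0 < \<rho>\<close> by (intro mult_left_mono divide_right_mono) auto
      also have "\<dots> = 12 * (2 + L) * real CARD('n) * a / \<rho> / real N * real (2 * n + 1) * M"
        by (simp only: divide_inverse mult_ac)
      finally show "\<exists>y'\<in>h ` G. \<bar>p y - p y'\<bar> \<le> 12 * (2 + L) * real CARD('n) * a / \<rho> / real N * real (2 * n + 1) * M"
        using \<xi>'(1) y_eq by blast
    qed
  qed
qed

text \<open>The cube and the Lipschitz constant are the same in all charts, so by compactness of the boundary finitely many patches suffice
  and their nets have the same quality.\<close>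

lemma boundary_net:
  fixes \<Omega> :: "(real ^ 'n) set"
  assumes "bounded \<Omega>" "lipschitz_domain \<Omega>" "0 < \<rho>" "interior_ball_property \<Omega> \<rho>"
  obtains c :: real and m :: nat where "0 \<le> c"
    "\<And>N. 1 \<le> N \<Longrightarrow> \<exists>Y. Y \<subseteq> frontier \<Omega> \<and> finite Y \<and> card Y \<le> m * (2 * N + 1) ^ (CARD('n) - 1) \<and>
      polynomial_net \<Omega> (frontier \<Omega>) Y (c / real N)"
proof -
  have "open \<Omega>"
    using assms(2) by (simp add: lipschitz_domain_def)
  obtain k :: 'n and L r :: real and B where L: "0 < L" and r: "0 < r"
    and B: "openin (top_of_set (base_hyperplane k)) B" "0 \<in> B"
    and charts: "\<And>x. x \<in> frontier \<Omega> \<Longrightarrow> \<exists>\<phi> R. graph_chart \<Omega> x k r B \<phi> R \<and> orthogonal_matrix R \<and> L-lipschitz_on B \<phi>"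
    by (rule lipschitz_domain_charts[OF assms(2)]) (rule that; assumption)
  obtain \<delta> where \<delta>: "\<delta> > 0" "\<And>\<zeta>. \<zeta> \<in> base_hyperplane k \<Longrightarrow> dist \<zeta> 0 < \<delta> \<Longrightarrow> \<zeta> \<in> B"
    using B unfolding openin_euclidean_subtopology_iff by blast
  \<comment> \<open>A cube of half side \<open>a\<close> has radius at most \<open>d a < \<delta>\<close>.\<close>
  define a where "a = min r (\<delta> / (2 * real CARD('n)))"
  have a: "0 < a" "a \<le> r"
    using r \<delta>(1) by (simp_all add: a_def)
  have cube: "\<xi> \<in> B" if "\<xi> \<in> base_hyperplane k" "\<And>i. \<bar>\<xi> $ i\<bar> \<le> a" for \<xi>
  proof (rule \<delta>(2)[OF that(1)])
    have "norm \<xi> \<le> (\<Sum>i\<in>UNIV. \<bar>\<xi> $ i\<bar>)"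
      by (rule norm_le_l1_cart)
    also have "\<dots> \<le> (\<Sum>i\<in>(UNIV :: 'n set). a)"
      by (intro sum_mono that(2))
    also have "\<dots> \<le> real CARD('n) * (\<delta> / (2 * real CARD('n)))"
      unfolding sum_constant by (intro mult_left_mono) (simp_all add: a_def)
    also have "\<dots> < \<delta>"
      using \<delta>(1) by simp
    finally show "dist \<xi> 0 < \<delta>"
      by simp
  qed
  define c where "c = 12 * (2 + L) * real CARD('n) * a / \<rho>"
  have "compact (frontier \<Omega>)"
    using assms(1) by (rule compact_frontier_bounded)
  then obtain D where D: "D \<subseteq> frontier \<Omega>" "finite D" "frontier \<Omega> \<subseteq> (\<Union>x\<in>D. ball x a)"
    by (rule compactE_image[of _ "frontier \<Omega>" "\<lambda>x. ball x a"]) (use a in auto)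
  show ?thesis
  proof (rule that[of c "card D"])
    show "0 \<le> c"
      using L a assms(3) by (simp add: c_def)
    fix N :: nat assume N: "1 \<le> N"
    have "\<forall>x\<in>D. \<exists>Y. Y \<subseteq> frontier \<Omega> \<and> finite Y \<and> card Y \<le> (2 * N + 1) ^ (CARD('n) - 1) \<and>
      polynomial_net \<Omega> (frontier \<Omega> \<inter> ball x a) Y (c / real N)"
    proof
      fix x assume "x \<in> D"
      then obtain \<phi> R where "graph_chart \<Omega> x k r B \<phi> R" "orthogonal_matrix R" "L-lipschitz_on B \<phi>"
        using charts D(1) by blast
      from boundary_patch_net[OF \<open>open \<Omega>\<close> assms(3,4) this L B(1) cube a N]
      obtain Y where "Y \<subseteq> frontier \<Omega>" "finite Y" "card Y \<le> (2 * N + 1) ^ (CARD('n) - 1)"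
        "polynomial_net \<Omega> (frontier \<Omega> \<inter> ball x a) Y (c / real N)"
        unfolding c_def .
      then show "\<exists>Y. Y \<subseteq> frontier \<Omega> \<and> finite Y \<and> card Y \<le> (2 * N + 1) ^ (CARD('n) - 1) \<and>
        polynomial_net \<Omega> (frontier \<Omega> \<inter> ball x a) Y (c / real N)"
        by blast
    qed
    then obtain Y where Y: "\<And>x. x \<in> D \<Longrightarrow> Y x \<subseteq> frontier \<Omega> \<and> finite (Y x) \<and>
      card (Y x) \<le> (2 * N + 1) ^ (CARD('n) - 1) \<and>
      polynomial_net \<Omega> (frontier \<Omega> \<inter> ball x a) (Y x) (c / real N)"
      by metis
    show "\<exists>Y. Y \<subseteq> frontier \<Omega> \<and> finite Y \<and> card Y \<le> card D * (2 * N + 1) ^ (CARD('n) - 1) \<and>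
      polynomial_net \<Omega> (frontier \<Omega>) Y (c / real N)"
    proof (intro exI conjI)
      show "(\<Union>x\<in>D. Y x) \<subseteq> frontier \<Omega>"
        using Y by blast
      show "finite (\<Union>x\<in>D. Y x)"
        using Y D(2) by blast
      have "card (\<Union>x\<in>D. Y x) \<le> (\<Sum>x\<in>D. card (Y x))"
        using D(2) by (rule card_UN_le)
      also have "\<dots> \<le> (\<Sum>x\<in>D. (2 * N + 1) ^ (CARD('n) - 1))"
        using Y by (intro sum_mono) blast
      finally show "card (\<Union>x\<in>D. Y x) \<le> card D * (2 * N + 1) ^ (CARD('n) - 1)"
        by simp
      show "polynomial_net \<Omega> (frontier \<Omega>) (\<Union>x\<in>D. Y x) (c / real N)"
        unfolding polynomial_net_def
      proof (intro allI impI ballI)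
        fix n p M y
        assume p: "poly_on_parabolas n p" "\<forall>z\<in>closure \<Omega>. \<bar>p z\<bar> \<le> M" and y: "y \<in> frontier \<Omega>"
        obtain x where x: "x \<in> D" "y \<in> ball x a"
          using D(3) y by blast
        then have "\<exists>y'\<in>Y x. \<bar>p y - p y'\<bar> \<le> c / real N * real (2 * n + 1) * M"
          using Y[OF x(1)] p y unfolding polynomial_net_def by blast
        then show "\<exists>y'\<in>\<Union>x\<in>D. Y x. \<bar>p y - p y'\<bar> \<le> c / real N * real (2 * n + 1) * M"
          using x(1) by blast
      qed
    qed
  qed
qed

section \<open>Starlike domains and the mesh\<close>

text \<open>On every line through \<open>a\<close>, a polynomial vanishing on \<open>K\<close> has infinitely many zeros.\<close>

lemma polynomial_determining_if_interior:
  fixes K :: "(real ^ 'n) set"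
  assumes "0 < e" "ball a e \<subseteq> K"
  shows "polynomial_determining K"
  unfolding polynomial_determining_def
proof (intro allI ballI impI)
  fix n and p :: "real ^ 'n \<Rightarrow> real"
  assume "p \<in> polys n" and zero: "\<forall>x\<in>K. p x = 0"
  show "p = (\<lambda>x. 0)"
  proof
    fix x
    obtain q where q: "\<And>s. p (a + s *\<^sub>R (x - a) + s\<^sup>2 *\<^sub>R 0) = poly q s"
      using poly_on_parabolas_polys[OF \<open>p \<in> polys n\<close>] unfolding poly_on_parabolas_def by blast
    define \<epsilon> where "\<epsilon> = e / (norm (x - a) + 1)"
    have \<epsilon>: "\<epsilon> > 0"
      using \<open>0 < e\<close> by (simp add: \<epsilon>_def add_nonneg_pos)
    have "poly q s = 0" if s: "s \<in> {0<..<\<epsilon>}" for s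
    proof -
      have "norm (s *\<^sub>R (x - a)) \<le> s * (norm (x - a) + 1)"
        using s by (simp add: distrib_left)
      also have "\<dots> < \<epsilon> * (norm (x - a) + 1)"
        using s by (intro mult_strict_right_mono) (auto simp: add_nonneg_pos)
      also have "\<dots> = e"
        using norm_ge_zero[of "x - a"] unfolding \<epsilon>_def by (simp add: add_nonneg_eq_0_iff)
      finally have "a + s *\<^sub>R (x - a) \<in> ball a e"
        by (simp add: dist_norm)
      then show ?thesis
        using q[of s] zero assms(2) by auto
    qed
    then have "{0<..<\<epsilon>} \<subseteq> {s. poly q s = 0}"
      by blast
    then have "q = 0"
      using \<epsilon> poly_roots_finite[of q] infinite_Ioo[of 0 \<epsilon>] finite_subset by blast
    then show "p x = 0"
      using q[of 1] by simp
  qed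
qed

text \<open>The ray from \<open>a\<close> through \<open>z\<close> leaves the bounded set \<open>\<Omega>\<close> beyond \<open>z\<close>.\<close>

lemma starlike_frontier_representation:
  fixes \<Omega> :: "'a::euclidean_space set"
  assumes "bounded \<Omega>" "open \<Omega>" "a \<in> \<Omega>" "z \<in> closure \<Omega>"
  obtains y t where "y \<in> frontier \<Omega>" "0 \<le> t" "t \<le> 1" "z = a + t *\<^sub>R (y - a)"
proof (cases "z \<in> \<Omega>")
  case False
  then have "z \<in> frontier \<Omega>"
    using assms by (simp add: frontier_def interior_open)
  then show ?thesis
    using that[of z 1] by simp
next
  case True
  then have z: "z \<in> interior \<Omega>"
    using \<open>open \<Omega>\<close> by (simp add: interior_open)
  show ?thesis
  proof (cases "z = a")
    case True
    obtain v :: 'a where "v \<noteq> 0"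
      using nonzero_Basis nonempty_Basis by blast
    then obtain d where "a + d *\<^sub>R v \<in> frontier \<Omega>"
      using ray_to_frontier[OF \<open>bounded \<Omega>\<close>, of a v] z True by blast
    then show ?thesis
      using that[of "a + d *\<^sub>R v" 0] True by simp
  next
    case False
    then obtain d where d: "0 < d" "z + d *\<^sub>R (z - a) \<in> frontier \<Omega>"
      using ray_to_frontier[OF \<open>bounded \<Omega>\<close> z, of "z - a"] by auto
    have "z + d *\<^sub>R (z - a) - a = (1 + d) *\<^sub>R (z - a)"
      by (simp add: algebra_simps)
    then have "(1 / (1 + d)) *\<^sub>R (z + d *\<^sub>R (z - a) - a) = z - a"
      using d(1) by simp
    then show ?thesis
      using that[OF d(2), of "1 / (1 + d)"] d(1) by simp
  qed
qed

lemma starlike_closure_homothety: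
  fixes \<Omega> :: "'a::euclidean_space set"
  assumes star: "\<And>x. x \<in> \<Omega> \<Longrightarrow> closed_segment a x \<subseteq> \<Omega>" and "0 \<le> t" "t \<le> 1" "z \<in> closure \<Omega>"
  shows "a + t *\<^sub>R (z - a) \<in> closure \<Omega>"
proof -
  have "(\<lambda>z. a + t *\<^sub>R (z - a)) ` closure \<Omega> \<subseteq> closure \<Omega>"
  proof (rule image_closure_subset)
    show "(\<lambda>z. a + t *\<^sub>R (z - a)) ` \<Omega> \<subseteq> closure \<Omega>"
    proof
      fix w assume "w \<in> (\<lambda>z. a + t *\<^sub>R (z - a)) ` \<Omega>"
      then obtain x where x: "x \<in> \<Omega>" "w = a + t *\<^sub>R (x - a)"
        by blast
      have "w = (1 - t) *\<^sub>R a + t *\<^sub>R x"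
        by (simp add: x(2) algebra_simps)
      then have "w \<in> closed_segment a x"
        using assms(2,3) unfolding closed_segment_def by blast
      then show "w \<in> closure \<Omega>"
        using star[OF x(1)] closure_subset by blast
    qed
  qed (auto intro!: continuous_intros)
  then show ?thesis
    using assms(4) by blast
qed

text \<open>With \<open>t = cos\<^sup>2 \<theta>\<close> the segment from \<open>a\<close> to \<open>y\<close> is a degenerate parabola, traversed over \<open>[-1, 1]\<close>, so equidistant angles provide a
  radial mesh. The factor \<open>48\<close> makes the bound \<open>3 (2 n + 1) M \<pi> / N\<close> at most \<open>M / 4\<close>, using \<open>\<pi> < 4\<close>.\<close>

lemma starlike_radial_step:
  fixes \<Omega> :: "'a::euclidean_space set"
  assumes star: "\<And>x. x \<in> \<Omega> \<Longrightarrow> closed_segment a x \<subseteq> \<Omega>"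
    and p: "poly_on_parabolas n p" and bound: "\<And>z. z \<in> closure \<Omega> \<Longrightarrow> \<bar>p z\<bar> \<le> M"
    and y: "y \<in> closure \<Omega>" and t: "0 \<le> t" "t \<le> 1" and N: "48 * (2 * n + 1) \<le> N"
  obtains j where "j \<le> N" "\<bar>p (a + t *\<^sub>R (y - a)) - p (a + (cos (real j * pi / real N))\<^sup>2 *\<^sub>R (y - a))\<bar> \<le> M / 4"
proof -
  define \<theta> where "\<theta> = arccos (sqrt t)"
  have "0 \<le> sqrt t"
    using t by simp
  then have st: "- 1 \<le> sqrt t" "sqrt t \<le> 1"
    using t by (linarith, simp)
  then have \<theta>: "0 \<le> \<theta>" "\<theta> \<le> pi" "(cos \<theta>)\<^sup>2 = t"
    unfolding \<theta>_def using t arccos_lbound arccos_ubound by (blast, blast, simp only: cos_arccos[OF st] real_sqrt_pow2)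
  have Npos: "0 < real N"
    using N by simp
  have M: "0 \<le> M"
    using bound[OF y] by simp
  define j where "j = nat \<lfloor>\<theta> * real N / pi\<rfloor>"
  have j0: "0 \<le> \<theta> * real N / pi"
    using \<theta>(1) by simp
  have j1: "\<theta> * real N / pi \<le> real N"
    using \<theta>(2) by (simp add: divide_simps mult.commute mult_right_mono)
  have j: "real j \<le> \<theta> * real N / pi" "\<theta> * real N / pi \<le> real j + 1"
    unfolding j_def using j0 by linarith+
  have "j \<le> N"
    using j(1) j1 by linarith
  have "\<bar>\<theta> - real j * pi / real N\<bar> \<le> pi / real N"
  proof -
    have "\<theta> - real j * pi / real N = (\<theta> * real N / pi - real j) * (pi / real N)"
      using Npos by (simp add: field_simps)
    also have "\<bar>\<dots>\<bar> \<le> 1 * (pi / real N)"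
      unfolding abs_mult using j Npos by (intro mult_mono) auto
    finally show ?thesis
      by simp
  qed
  also have "pi / real N \<le> 4 / real (48 * (2 * n + 1))"
    using N pi_less_4 by (intro frac_le) (auto simp del: of_nat_mult of_nat_add)
  finally have angle: "\<bar>\<theta> - real j * pi / real N\<bar> \<le> 4 / real (48 * (2 * n + 1))" .
  have "\<bar>p (a + s *\<^sub>R 0 + s\<^sup>2 *\<^sub>R (y - a))\<bar> \<le> M" if "\<bar>s\<bar> \<le> 1" for s
    using starlike_closure_homothety[OF star _ _ y, of "s\<^sup>2"] that bound by (simp add: abs_square_le_1)
  from parabola_cos_increment[OF p this, of \<theta> "real j * pi / real N"]
  have "\<bar>p (a + t *\<^sub>R (y - a)) - p (a + (cos (real j * pi / real N))\<^sup>2 *\<^sub>R (y - a))\<bar>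
    \<le> 3 * real (2 * n + 1) * M * \<bar>\<theta> - real j * pi / real N\<bar>"
    by (simp add: \<theta>(3))
  also have "\<dots> \<le> 3 * real (2 * n + 1) * M * (4 / real (48 * (2 * n + 1)))"
    using angle M by (intro mult_left_mono) auto
  also have "\<dots> = M / 4"
    by (simp add: field_simps)
  finally show ?thesis
    using that[OF \<open>j \<le> N\<close>] by blast
qed

text \<open>Starting from a maximum point \<open>a + t (y - a)\<close> of \<open>\<bar>p\<bar>\<close>, the parameter is first rounded to
  some \<open>t'\<close>, and then \<open>y\<close> to a point of the net; the second estimate concerns the polynomial
  \<open>z \<mapsto> p (a + t' (z - a))\<close>, which obeys the same bound on the closure of \<open>\<Omega>\<close>. Each step loses at most a quarter of the maximum.\<close>

lemma starlike_mesh_estimate: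
  fixes \<Omega> :: "'a::euclidean_space set"
  assumes "bounded \<Omega>" "open \<Omega>" "a \<in> \<Omega>" and star: "\<And>x. x \<in> \<Omega> \<Longrightarrow> closed_segment a x \<subseteq> \<Omega>"
    and p: "poly_on_parabolas n p"
    and net: "polynomial_net \<Omega> (frontier \<Omega>) Y \<epsilon>" and \<epsilon>: "\<epsilon> * real (2 * n + 1) \<le> 1 / 4"
    and N: "48 * (2 * n + 1) \<le> N"
  obtains j y where "j \<le> N" "y \<in> Y"
    "\<And>z. z \<in> closure \<Omega> \<Longrightarrow> \<bar>p z\<bar> \<le> 2 * \<bar>p (a + (cos (real j * pi / real N))\<^sup>2 *\<^sub>R (y - a))\<bar>"
proof -
  have "compact (closure \<Omega>)" "closure \<Omega> \<noteq> {}"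
    using assms(1,3) by auto
  moreover have "continuous_on (closure \<Omega>) (\<lambda>z. \<bar>p z\<bar>)"
    using p continuous_on_subset unfolding poly_on_parabolas_def by (blast intro: continuous_on_rabs)
  ultimately obtain z0 where z0: "z0 \<in> closure \<Omega>" "\<And>z. z \<in> closure \<Omega> \<Longrightarrow> \<bar>p z\<bar> \<le> \<bar>p z0\<bar>"
    using continuous_attains_sup[of "closure \<Omega>" "\<lambda>z. \<bar>p z\<bar>"] by blast
  define M where "M = \<bar>p z0\<bar>"
  obtain y t where y: "y \<in> frontier \<Omega>" and t: "0 \<le> t" "t \<le> 1" and z0_eq: "z0 = a + t *\<^sub>R (y - a)"
    using starlike_frontier_representation[OF assms(1-3) z0(1)] .
  have bound: "\<bar>p z\<bar> \<le> M" if "z \<in> closure \<Omega>" for z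
    using z0(2)[OF that] by (simp add: M_def)
  have "y \<in> closure \<Omega>"
    using y by (simp add: frontier_def)
  then obtain j where j: "j \<le> N"
    "\<bar>p z0 - p (a + (cos (real j * pi / real N))\<^sup>2 *\<^sub>R (y - a))\<bar> \<le> M / 4"
    using starlike_radial_step[OF star p bound _ t N] unfolding z0_eq by blast
  define t' where "t' = (cos (real j * pi / real N))\<^sup>2"
  have t': "0 \<le> t'" "t' \<le> 1"
    by (simp_all add: t'_def abs_square_le_1)
  have "\<forall>z\<in>closure \<Omega>. \<bar>p (a + t' *\<^sub>R (z - a))\<bar> \<le> M"
    using starlike_closure_homothety[OF star t'] bound by blast
  then obtain y' where y': "y' \<in> Y"
    "\<bar>p (a + t' *\<^sub>R (y - a)) - p (a + t' *\<^sub>R (y' - a))\<bar> \<le> \<epsilon> * real (2 * n + 1) * M"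
    using net poly_on_parabolas_homothety[OF p, of a t'] y unfolding polynomial_net_def by blast
  have "\<epsilon> * real (2 * n + 1) * M \<le> 1 / 4 * M"
    using \<epsilon> by (intro mult_right_mono) (auto simp: M_def)
  then have "M \<le> \<bar>p (a + t' *\<^sub>R (y' - a))\<bar> + M / 2"
    using j(2) y'(2) unfolding M_def t'_def by linarith
  then show ?thesis
    using that[OF j(1) y'(1)] bound unfolding t'_def by force
qed

lemma sup_norm_le_of_witness:
  assumes "z \<in> A" "0 \<le> C" "\<And>x. x \<in> K \<Longrightarrow> \<bar>p x\<bar> \<le> C * \<bar>p z\<bar>"
  shows "sup_norm K p \<le> ennreal C * sup_norm A p"
proof -
  have "sup_norm K p \<le> ennreal (C * \<bar>p z\<bar>)"
    unfolding sup_norm_def using assms(3) by (intro SUP_least ennreal_leI)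
  also have "\<dots> = ennreal C * ennreal \<bar>p z\<bar>"
    using assms(2) by (simp add: ennreal_mult)
  also have "\<dots> \<le> ennreal C * sup_norm A p"
    unfolding sup_norm_def using assms(1) by (intro mult_left_mono SUP_upper) auto
  finally show ?thesis .
qed

theorem theorem2p2:
  fixes \<Omega> :: "(real ^ 'n) set"
  assumes "bounded \<Omega>"
    and "starlike \<Omega>"
    and "lipschitz_domain \<Omega>"
    and "positive_reach (- \<Omega>)"
  shows "\<exists>A. optimal_admissible_mesh (closure \<Omega>) A"
proof -
  have "open \<Omega>"
    using assms(3) by (simp add: lipschitz_domain_def)
  obtain a where a: "a \<in> \<Omega>" and star: "\<And>x. x \<in> \<Omega> \<Longrightarrow> closed_segment a x \<subseteq> \<Omega>"
    using assms(2) unfolding starlike_def by blast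
  obtain R where R: "0 < R" "\<And>b. b \<in> - \<Omega> \<Longrightarrow> ball b R \<subseteq> Unp (- \<Omega>)"
    using positive_reach_uniform[OF assms(4)] by blast
  have "interior_ball_property \<Omega> (R / 2)"
    unfolding interior_ball_property_def
  proof
    fix y assume "y \<in> frontier \<Omega>"
    then obtain \<nu> where "norm \<nu> = 1" "ball (y + (R / 2) *\<^sub>R \<nu>) (R / 2) \<subseteq> \<Omega>"
      using frontier_inner_ball[OF \<open>open \<Omega>\<close>, of R "R / 2" y] R by auto
    then show "\<exists>\<nu>. norm \<nu> = 1 \<and> ball (y + (R / 2) *\<^sub>R \<nu>) (R / 2) \<subseteq> \<Omega>"
      by blast
  qed
  then obtain c :: real and m :: nat where c: "0 \<le> c"
    and nets: "\<And>N. 1 \<le> N \<Longrightarrow> \<exists>Y. Y \<subseteq> frontier \<Omega> \<and> finite Y \<and> card Y \<le> m * (2 * N + 1) ^ (CARD('n) - 1) \<and>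
      polynomial_net \<Omega> (frontier \<Omega>) Y (c / real N)"
    using boundary_net[OF assms(1,3), of "R / 2"] R(1) by auto
  define l where "l n = 2 * n + 1" for n :: nat
  \<comment> \<open>With \<open>b (2 n + 1)\<close> grid steps the boundary net loses at most a quarter of the maximum.\<close>
  define b where "b = nat \<lceil>4 * c\<rceil> + 1"
  have b: "4 * c \<le> real b" "1 \<le> b"
    unfolding b_def by linarith+
  have bl: "1 \<le> b * l n" for n
    using b(2) by (simp add: l_def)
  then have "\<forall>n. \<exists>Y. Y \<subseteq> frontier \<Omega> \<and> finite Y \<and> card Y \<le> m * (2 * (b * l n) + 1) ^ (CARD('n) - 1) \<and>
      polynomial_net \<Omega> (frontier \<Omega>) Y (c / real (b * l n))"
    using nets by blast
  then obtain Y where Y: "\<And>n. Y n \<subseteq> frontier \<Omega>" "\<And>n. finite (Y n)"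
    "\<And>n. card (Y n) \<le> m * (2 * (b * l n) + 1) ^ (CARD('n) - 1)"
    "\<And>n. polynomial_net \<Omega> (frontier \<Omega>) (Y n) (c / real (b * l n))"
    by metis
  define f where "f n = (\<lambda>(j, y). a + (cos (real j * pi / real (48 * l n)))\<^sup>2 *\<^sub>R (y - a))" for n
  define A where "A n = f n ` ({..48 * l n} \<times> Y n)" for n
  have A_finite: "finite (A n)" for n
    using Y(2) by (simp add: A_def)
  have A_sub: "A n \<subseteq> closure \<Omega>" for n
  proof
    fix z assume "z \<in> A n"
    then obtain j y where "y \<in> Y n" and z: "z = a + (cos (real j * pi / real (48 * l n)))\<^sup>2 *\<^sub>R (y - a)"
      unfolding A_def f_def by auto
    then have "y \<in> closure \<Omega>"
      using Y(1) by (auto simp: frontier_def)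
    then show "z \<in> closure \<Omega>"
      unfolding z by (intro starlike_closure_homothety[OF star]) (simp_all add: abs_square_le_1)
  qed
  have A_norm: "sup_norm (closure \<Omega>) p \<le> ennreal 2 * sup_norm (A n) p" if p: "p \<in> polys n" for n p
  proof -
    have "c / real (b * l n) * real (2 * n + 1) \<le> 1 / 4"
    proof -
      have "c / real (b * l n) * real (2 * n + 1) = c / real b"
        unfolding l_def[symmetric] using bl[of n] by simp
      also have "\<dots> \<le> 1 / 4"
        using b by (simp add: divide_simps)
      finally show ?thesis .
    qed
    then obtain j y where "j \<le> 48 * l n" "y \<in> Y n"
      and *: "\<And>z. z \<in> closure \<Omega> \<Longrightarrow> \<bar>p z\<bar> \<le> 2 * \<bar>p (f n (j, y))\<bar>"
      using starlike_mesh_estimate[OF assms(1) \<open>open \<Omega>\<close> a star poly_on_parabolas_polys[OF p] Y(4), of n "48 * l n"]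
      unfolding f_def l_def by auto
    then have "f n (j, y) \<in> A n"
      unfolding A_def by blast
    then show ?thesis
      using * by (intro sup_norm_le_of_witness) auto
  qed
  have A_card: "(\<lambda>n. real (card (A n))) \<in> O(\<lambda>n. real n ^ CARD('n))"
  proof (rule bigoI)
    define C where "C = 49 * (real m * (2 * real b + 1) ^ (CARD('n) - 1)) * 3 ^ CARD('n)"
    have card_le: "real (card (A n)) \<le> C * real n ^ CARD('n)" if n: "1 \<le> n" for n
    proof -
      have l: "1 \<le> l n" "l n \<le> 3 * n"
        using n by (simp_all add: l_def)
      have "card (A n) \<le> card ({..48 * l n} \<times> Y n)"
        unfolding A_def using Y(2) by (intro card_image_le) auto
      also have "\<dots> = (48 * l n + 1) * card (Y n)"
        by (simp add: card_cartesian_product)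
      also have "\<dots> \<le> (49 * l n) * (m * ((2 * b + 1) * l n) ^ (CARD('n) - 1))"
      proof (intro mult_le_mono)
        have "2 * (b * l n) + 1 \<le> (2 * b + 1) * l n"
          using l(1) by (simp add: algebra_simps)
        then have "(2 * (b * l n) + 1) ^ (CARD('n) - 1) \<le> ((2 * b + 1) * l n) ^ (CARD('n) - 1)"
          by (intro power_mono) auto
        then show "card (Y n) \<le> m * ((2 * b + 1) * l n) ^ (CARD('n) - 1)"
          using Y(3)[of n] by (meson mult_le_mono2 order_trans)
      qed (use l in simp)
      also have "\<dots> = 49 * (m * (2 * b + 1) ^ (CARD('n) - 1)) * (l n * l n ^ (CARD('n) - 1))"
        by (simp only: power_mult_distrib mult_ac)
      also have "l n * l n ^ (CARD('n) - 1) = l n ^ CARD('n)"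
        by (simp flip: power_Suc)
      also have "49 * (m * (2 * b + 1) ^ (CARD('n) - 1)) * l n ^ CARD('n)
          \<le> 49 * (m * (2 * b + 1) ^ (CARD('n) - 1)) * (3 * n) ^ CARD('n)"
        using l(2) by (intro mult_le_mono2 power_mono) auto
      finally have "real (card (A n)) \<le> real (49 * (m * (2 * b + 1) ^ (CARD('n) - 1)) * (3 * n) ^ CARD('n))"
        by (rule of_nat_mono)
      then show ?thesis
        by (simp add: C_def power_mult_distrib ac_simps)
    qed
    show "\<forall>\<^sub>F n in sequentially. norm (real (card (A n))) \<le> C * norm (real n ^ CARD('n))"
      using eventually_ge_at_top[of 1] by (rule eventually_mono) (use card_le in simp)
  qed
  obtain e where "0 < e" "ball a e \<subseteq> \<Omega>"
    using \<open>open \<Omega>\<close> a openE by blast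
  then have "polynomial_determining (closure \<Omega>)"
    using polynomial_determining_if_interior closure_subset by (metis subset_trans)
  moreover have "compact (closure \<Omega>)"
    using assms(1) by simp
  ultimately have "admissible_mesh (closure \<Omega>) A"
    unfolding admissible_mesh_def using A_finite A_sub A_card A_norm
    by (intro conjI allI exI[of _ "CARD('n)"] exI[of _ "2 :: real"]) auto
  then have "optimal_admissible_mesh (closure \<Omega>) A"
    using A_card by (simp add: optimal_admissible_mesh_def)
  then show ?thesis
    by blast
qed

end
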